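(* Let $\rho,E$ (scalars) and $\boldsymbol V,\boldsymbol B$ (vector fields) be conical fields (smooth, say) on a conical region of $\mathbb{R}^3\setminus\{0\}$ with coordinates $(x^1,x^2,x^3)=(\xi^1,\xi^2,r)$, where $r$ is the distance to the origin and $(\xi^1,\xi^2)$ are arbitrary coordinates on (an open piece of) the unit sphere. Let $P=P(\rho,e)$ be the pressure and $\mu>0$ a constant. Then $(\rho,\boldsymbol V,E,\boldsymbol B)$ satisfies the steady ideal MHD equations with Powell source terms, $$\left(\rho\sqrt{G}V^j\right)_{|j}=0,$$ $$\left(\sqrt{G}\left[\rho V^iV^j-\tfrac1\mu B^iB^j+G^{ij}\left(P+\tfrac{|\boldsymbol B|^2}{2\mu}\right)\right]\right)_{|j}=-\tfrac{\sqrt G}{\mu}B^iB^j_{|j},$$ $$\left(\sqrt{G}\left[\left(\rho E+P+\tfrac{|\boldsymbol B|^2}{\mu}\right)V^j-\tfrac1\mu(\boldsymbol V\cdot\boldsymbol B)B^j\right]\right)_{|j}=-\tfrac{\sqrt G}{\mu}(\boldsymbol V\cdot\boldsymbol B)B^j_{|j},$$ $$(V^jB^i-V^iB^j)_{|j}=-V^iB^j_{|j}\qquad(i=1,2,3),$$ if and only if the $r$-independent quantities $\rho,E,v^\alpha,V^3,b^\alpha,B^3$ satisfy the following system on the unit sphere (with $\alpha=1,2$ in the free-index equations): $$\frac{\partial}{\partial\xi^\beta}\left(\rho\sqrt g\,v^\beta\right)+2\rho\sqrt g\,V^3=0,$$ $$\left[\sqrt g\left(\rho v^\alpha v^\beta-\tfrac1\mu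 b^\alpha b^\beta+g^{\alpha\beta}\left[P+\tfrac{|\boldsymbol B|^2}{2\mu}\right]\right)\right]_{||\beta}+3\sqrt g\left(\rho v^\alpha V^3-\tfrac1\mu b^\alpha B^3\right)=-\tfrac{\sqrt g}{\mu}b^\alpha\left(b^\nu_{||\nu}+2B^3\right),$$ $$\frac{\partial}{\partial\xi^\alpha}\left(\rho\sqrt g\,V^3v^\alpha-\tfrac{\sqrt g}{\mu}B^3b^\alpha\right)+2\sqrt g\left(\rho(V^3)^2-\tfrac1\mu(B^3)^2\right)-\rho\sqrt g\,v_c^2+\tfrac{\sqrt g}{\mu}b_c^2=-\tfrac{\sqrt g}{\mu}B^3\left(b^\nu_{||\nu}+2B^3\right),$$ $$\frac{\partial}{\partial\xi^\beta}\left(\sqrt g\left[\left(\rho E+P+\tfrac{|\boldsymbol B|^2}{\mu}\right)v^\beta-\tfrac1\mu(\boldsymbol V\cdot\boldsymbol B)b^\beta\right]\right)+2\sqrt g\left[\left(\rho E+P+\tfrac{|\boldsymbol B|^2}{\mu}\right)V^3-\tfrac1\mu(\boldsymbol V\cdot\boldsymbol B)B^3\right]=-\tfrac{\sqrt g}{\mu}(\boldsymbol V\cdot\boldsymbol B)\left(b^\nu_{||\nu}+2B^3\right),$$ $$(v^\beta b^\alpha-v^\alpha b^\beta)_{||\beta}+(V^3b^\alpha-v^\alpha B^3)=-v^\alpha\left(b^\nu_{||\nu}+2B^3\right),$$ $$\frac{\partial}{\partial\xi^\beta}(v^\beta B^3-V^3b^\beta)+(v^\beta B^3-V^3b^\beta)\frac{1}{\sqrt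 g}\frac{\partial\sqrt g}{\partial\xi^\beta}=-V^3\left(b^\nu_{||\nu}+2B^3\right).$$
   Context: Indices and summation: Latin indices run over $1,2,3$, Greek indices over $1,2$; repeated indices are summed. Metrics: $G_{ij}$ is the Euclidean metric of $\mathbb{R}^3$ in the coordinates $(\xi^1,\xi^2,r)$, with inverse $G^{ij}$ and determinant $G$. It has the form $G_{33}=1$, $G_{\alpha3}=G_{3\alpha}=0$, $G_{\alpha\beta}=r^2g_{\alpha\beta}$, where $g_{\alpha\beta}=g_{\alpha\beta}(\xi^1,\xi^2)$ is the metric of the unit sphere, with inverse $g^{\alpha\beta}$ and determinant $g$. Thus $\sqrt G=r^2\sqrt g$. Components: a vector field $\boldsymbol W$ has contravariant components $(\tilde w^1,\tilde w^2,W^3)=(W^1,W^2,W^3)$ in the coordinates $(\xi^1,\xi^2,r)$, and its rescaled surface components are $w^\alpha=r\tilde w^\alpha$. Accordingly $v^\alpha=rV^\alpha$, $b^\alpha=rB^\alpha$. Also $v_c^2=g_{\alpha\beta}v^\alpha v^\beta$, $b_c^2=g_{\alpha\beta}b^\alpha b^\beta$, $|\boldsymbol V|^2=v_c^2+(V^3)^2$, $|\boldsymbol B|^2=b_c^2+(B^3)^2$, $\boldsymbol V\cdot\boldsymbol B=g_{\alpha\beta}v^\alpha b^\beta+V^3B^3$. Physical quantities: $\rho$ is the density, $E=e+\frac12|\boldsymbol V|^2$ the total specific energy, $e$ the specific thermal energy, $P=P(\rho,e)$ a given gas law, $\boldsymbol V$ the velocity, $\boldsymbol B$ the magnetic field.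 Conical: a scalar or tensor quantity is conical if its covariant derivative in the $r$ direction vanishes identically; for a scalar this means $\partial/\partial r=0$, and for a vector field $W^i_{|3}=0$ for all $i$. For a conical vector field the components $w^\alpha$ and $W^3$ are independent of $r$. Covariant derivatives: $(\cdot)_{|j}$ denotes the (Levi-Civita) covariant derivative of $G_{ij}$ in $\mathbb{R}^3$ and $(\cdot)_{||\beta}$ that of $g_{\alpha\beta}$ on the unit sphere, with Christoffel symbols $\Gamma$ of the respective metric. Quantities carrying a factor $\sqrt G$ (resp. $\sqrt g$) are treated as relative tensors of weight 1 (tensor densities). Explicitly, in three dimensions: for a vector $B^j$ (weight 0), $B^j_{|j}=\partial_jB^j+\Gamma^k_{jk}B^j$; for a vector density $W^j$ of weight 1, $W^j_{|j}=\partial_jW^j$; for a rank 2 density $W^{ij}$ of weight 1, $W^{ij}_{|j}=\partial_jW^{ij}+\Gamma^i_{hk}W^{hk}$; for a rank 2 tensor $W^{ij}$ of weight 0, $W^{ij}_{|j}=\partial_jW^{ij}+\Gamma^i_{hk}W^{hk}+\Gamma^k_{hk}W^{ih}$. The same formulas, with Greek indices, $\partial/\partial\xi^\beta$ and the Christoffel symbols of $g_{\alpha\beta}$, define $(\cdot)_{||\beta}$ on the sphere. *)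

theory Defs
  imports "HOL-Analysis.Analysis"
begin

text \<open>Continuous differentiability of order \<open>k\<close>; only meant for open sets \<open>S\<close>.\<close>

primrec Ck_on :: "nat \<Rightarrow> 'a::euclidean_space set \<Rightarrow> ('a \<Rightarrow> 'b::real_normed_vector) \<Rightarrow> bool" where
  "Ck_on 0 S f \<longleftrightarrow> continuous_on S f"
| "Ck_on (Suc k) S f \<longleftrightarrow>
     (\<forall>x\<in>S. f differentiable (at x)) \<and> (\<forall>v. Ck_on k S (\<lambda>x. frechet_derivative f (at x) v))"

definition smooth_on :: "'a::euclidean_space set \<Rightarrow> ('a \<Rightarrow> 'b::real_normed_vector) \<Rightarrow> bool" where
  "smooth_on S f \<longleftrightarrow> (\<forall>k. Ck_on k S f)"

definition pd :: "'m::finite \<Rightarrow> (real^'m \<Rightarrow> 'b::real_normed_vector) \<Rightarrow> real^'m \<Rightarrow> 'b" where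
  "pd i f y = vector_derivative (\<lambda>t. f (y + t *\<^sub>R axis i 1)) (at 0)"


subsection \<open>Tensor calculus in coordinates\<close>

text \<open>
  A parametrisation \<open>F\<close> maps coordinates to points of Euclidean space; the metric in these
  coordinates is the pull-back of the Euclidean inner product.  Fields are functions of the
  coordinates.  A contravariant tensor of rank two is a matrix \<open>W $ i $ j\<close>.
\<close>

definition metric_tensor :: "(real^'m::finite \<Rightarrow> real^3) \<Rightarrow> real^'m \<Rightarrow> real^'m^'m" where
  "metric_tensor F y = (\<chi> i j. pd i F y \<bullet> pd j F y)"

definition christoffel :: "(real^'m::finite \<Rightarrow> real^'m^'m) \<Rightarrow> real^'m \<Rightarrow> 'm \<Rightarrow> 'm \<Rightarrow> 'm \<Rightarrow> real" where
  "christoffel M y i j k =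
     (\<Sum>l\<in>UNIV. matrix_inv (M y) $ i $ l *
        (pd j (\<lambda>z. M z $ l $ k) y + pd k (\<lambda>z. M z $ l $ j) y - pd l (\<lambda>z. M z $ j $ k) y)) / 2"

definition cov_deriv ::
  "(real^'m::finite \<Rightarrow> real^'m^'m) \<Rightarrow> (real^'m \<Rightarrow> real^'m) \<Rightarrow> real^'m \<Rightarrow> 'm \<Rightarrow> 'm \<Rightarrow> real" where
  "cov_deriv M W y i j =
     pd j (\<lambda>z. W z $ i) y + (\<Sum>k\<in>UNIV. christoffel M y i j k * W y $ k)"

text \<open>
  Divergences (contraction of the covariant derivative with the last index).  The digits give
  the rank of the tensor and its weight as a relative tensor.
\<close>

definition div10 :: "(real^'m::finite \<Rightarrow> real^'m^'m) \<Rightarrow> (real^'m \<Rightarrow> real^'m) \<Rightarrow> real^'m \<Rightarrow> real" where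
  "div10 M W y =
     (\<Sum>j\<in>UNIV. pd j (\<lambda>z. W z $ j) y) + (\<Sum>j\<in>UNIV. \<Sum>k\<in>UNIV. christoffel M y k j k * W y $ j)"

definition div11 :: "(real^'m::finite \<Rightarrow> real^'m) \<Rightarrow> real^'m \<Rightarrow> real" where
  "div11 W y = (\<Sum>j\<in>UNIV. pd j (\<lambda>z. W z $ j) y)"

definition div21 ::
  "(real^'m::finite \<Rightarrow> real^'m^'m) \<Rightarrow> (real^'m \<Rightarrow> real^'m^'m) \<Rightarrow> real^'m \<Rightarrow> 'm \<Rightarrow> real" where
  "div21 M W y i =
     (\<Sum>j\<in>UNIV. pd j (\<lambda>z. W z $ i $ j) y)
     + (\<Sum>h\<in>UNIV. \<Sum>k\<in>UNIV. christoffel M y i h k * W y $ h $ k)"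

definition div20 ::
  "(real^'m::finite \<Rightarrow> real^'m^'m) \<Rightarrow> (real^'m \<Rightarrow> real^'m^'m) \<Rightarrow> real^'m \<Rightarrow> 'm \<Rightarrow> real" where
  "div20 M W y i =
     (\<Sum>j\<in>UNIV. pd j (\<lambda>z. W z $ i $ j) y)
     + (\<Sum>h\<in>UNIV. \<Sum>k\<in>UNIV. christoffel M y i h k * W y $ h $ k)
     + (\<Sum>h\<in>UNIV. \<Sum>k\<in>UNIV. christoffel M y k h k * W y $ i $ h)"

definition contravariant ::
  "(real^3 \<Rightarrow> real^3) \<Rightarrow> (real^3 \<Rightarrow> real^3) \<Rightarrow> real^3 \<Rightarrow> real^3" where
  "contravariant F W y = (THE w. W (F y) = (\<Sum>i\<in>UNIV. w $ i *\<^sub>R pd i F y))"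


subsection \<open>Coordinates adapted to a cone\<close>

text \<open>
  An injective immersion of an open subset of the plane into the sphere is a diffeomorphism
  onto an open piece of the sphere.
\<close>

definition sphere_chart :: "(real^2) set \<Rightarrow> (real^2 \<Rightarrow> real^3) \<Rightarrow> bool" where
  "sphere_chart U n \<longleftrightarrow>
     open U \<and> smooth_on U n \<and> inj_on n U \<and> n ` U \<subseteq> sphere 0 1 \<and>
     (\<forall>\<xi>\<in>U. inj (frechet_derivative n (at \<xi>)))"

definition angular :: "real^3 \<Rightarrow> real^2" where
  "angular y = vector [y $ 1, y $ 2]"

definition coords :: "real^2 \<Rightarrow> real \<Rightarrow> real^3" where
  "coords \<xi> r = vector [\<xi> $ 1, \<xi> $ 2, r]"

definition polar :: "(real^2 \<Rightarrow> real^3) \<Rightarrow> real^3 \<Rightarrow> real^3" where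
  "polar n y = y $ 3 *\<^sub>R n (angular y)"

definition coord_domain :: "(real^2) set \<Rightarrow> (real^3) set" where
  "coord_domain U = {y. angular y \<in> U \<and> 0 < y $ 3}"

definition cone_region :: "(real^2) set \<Rightarrow> (real^2 \<Rightarrow> real^3) \<Rightarrow> (real^3) set" where
  "cone_region U n = polar n ` coord_domain U"

definition conical_scalar ::
  "(real^2) set \<Rightarrow> (real^2 \<Rightarrow> real^3) \<Rightarrow> (real^3 \<Rightarrow> real) \<Rightarrow> bool" where
  "conical_scalar U n f \<longleftrightarrow> (\<forall>y\<in>coord_domain U. pd 3 (\<lambda>z. f (polar n z)) y = 0)"

definition conical_vector ::
  "(real^2) set \<Rightarrow> (real^2 \<Rightarrow> real^3) \<Rightarrow> (real^3 \<Rightarrow> real^3) \<Rightarrow> bool" where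
  "conical_vector U n W \<longleftrightarrow>
     (\<forall>y\<in>coord_domain U. \<forall>i.
        cov_deriv (metric_tensor (polar n)) (contravariant (polar n) W) y i 3 = 0)"

text \<open>
  The quantities on the sphere attached to a field on the cone, read off at distance \<open>r\<close>
  from the origin.
\<close>

definition surf_scalar ::
  "(real^2 \<Rightarrow> real^3) \<Rightarrow> real \<Rightarrow> (real^3 \<Rightarrow> real) \<Rightarrow> real^2 \<Rightarrow> real" where
  "surf_scalar n r f \<xi> = f (polar n (coords \<xi> r))"

definition surf_tangential ::
  "(real^2 \<Rightarrow> real^3) \<Rightarrow> real \<Rightarrow> (real^3 \<Rightarrow> real^3) \<Rightarrow> real^2 \<Rightarrow> real^2" where
  "surf_tangential n r W \<xi> =
     (let w = contravariant (polar n) W (coords \<xi> r) in vector [r * w $ 1, r * w $ 2])"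

definition surf_radial ::
  "(real^2 \<Rightarrow> real^3) \<Rightarrow> real \<Rightarrow> (real^3 \<Rightarrow> real^3) \<Rightarrow> real^2 \<Rightarrow> real" where
  "surf_radial n r W \<xi> = contravariant (polar n) W (coords \<xi> r) $ 3"


subsection \<open>The two systems\<close>

text \<open>
  The pressure law \<open>P\<close> takes the pair of density and specific thermal energy; the latter is
  the total specific energy minus the specific kinetic energy.
\<close>

definition powell_mhd ::
  "(real^3) set \<Rightarrow> (real^3 \<Rightarrow> real^3) \<Rightarrow> (real \<times> real \<Rightarrow> real) \<Rightarrow> real \<Rightarrow>
   (real^3 \<Rightarrow> real) \<Rightarrow> (real^3 \<Rightarrow> real^3) \<Rightarrow> (real^3 \<Rightarrow> real) \<Rightarrow> (real^3 \<Rightarrow> real^3) \<Rightarrow> bool" where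
  "powell_mhd D F P \<mu> \<rho>0 V0 E0 B0 \<longleftrightarrow>
    (let G = metric_tensor F;
         sG = (\<lambda>y. sqrt (det (G y)));
         V = contravariant F V0;
         B = contravariant F B0;
         \<rho> = (\<lambda>y. \<rho>0 (F y));
         E = (\<lambda>y. E0 (F y));
         BB = (\<lambda>y. B0 (F y) \<bullet> B0 (F y));
         VB = (\<lambda>y. V0 (F y) \<bullet> B0 (F y));
         p = (\<lambda>y. P (\<rho> y, E y - (V0 (F y) \<bullet> V0 (F y)) / 2))
     in \<forall>y\<in>D.
       div11 (\<lambda>z. \<chi> j. \<rho> z * sG z * V z $ j) y = 0
     \<and> (\<forall>i. div21 G (\<lambda>z. \<chi> i j. sG z * (\<rho> z * V z $ i * V z $ j - 1 / \<mu> * B z $ i * B z $ j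
                + matrix_inv (G z) $ i $ j * (p z + BB z / (2 * \<mu>)))) y i
            = - (sG y / \<mu>) * B y $ i * div10 G B y)
     \<and> div11 (\<lambda>z. \<chi> j. sG z * ((\<rho> z * E z + p z + BB z / \<mu>) * V z $ j
                - 1 / \<mu> * VB z * B z $ j)) y
         = - (sG y / \<mu>) * VB y * div10 G B y
     \<and> (\<forall>i. div20 G (\<lambda>z. \<chi> i j. V z $ j * B z $ i - V z $ i * B z $ j) y i
            = - V y $ i * div10 G B y))"

definition spherical_mhd ::
  "(real^2) set \<Rightarrow> (real^2 \<Rightarrow> real^3) \<Rightarrow> (real \<times> real \<Rightarrow> real) \<Rightarrow> real \<Rightarrow>
   (real^2 \<Rightarrow> real) \<Rightarrow> (real^2 \<Rightarrow> real^2) \<Rightarrow> (real^2 \<Rightarrow> real) \<Rightarrow>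
   (real^2 \<Rightarrow> real) \<Rightarrow> (real^2 \<Rightarrow> real^2) \<Rightarrow> (real^2 \<Rightarrow> real) \<Rightarrow> bool" where
  "spherical_mhd U n P \<mu> \<rho> v V3 E b B3 \<longleftrightarrow>
    (let g = metric_tensor n;
         sg = (\<lambda>\<xi>. sqrt (det (g \<xi>)));
         vv = (\<lambda>\<xi>. \<Sum>\<alpha>\<in>UNIV. \<Sum>\<beta>\<in>UNIV. g \<xi> $ \<alpha> $ \<beta> * v \<xi> $ \<alpha> * v \<xi> $ \<beta>);
         bb = (\<lambda>\<xi>. \<Sum>\<alpha>\<in>UNIV. \<Sum>\<beta>\<in>UNIV. g \<xi> $ \<alpha> $ \<beta> * b \<xi> $ \<alpha> * b \<xi> $ \<beta>);
         VV = (\<lambda>\<xi>. vv \<xi> + (V3 \<xi>)\<^sup>2);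
         BB = (\<lambda>\<xi>. bb \<xi> + (B3 \<xi>)\<^sup>2);
         VB = (\<lambda>\<xi>. (\<Sum>\<alpha>\<in>UNIV. \<Sum>\<beta>\<in>UNIV. g \<xi> $ \<alpha> $ \<beta> * v \<xi> $ \<alpha> * b \<xi> $ \<beta>) + V3 \<xi> * B3 \<xi>);
         p = (\<lambda>\<xi>. P (\<rho> \<xi>, E \<xi> - VV \<xi> / 2));
         h = (\<lambda>\<xi>. \<rho> \<xi> * E \<xi> + p \<xi> + BB \<xi> / \<mu>);
         dB = (\<lambda>\<xi>. div10 g b \<xi> + 2 * B3 \<xi>)
     in \<forall>\<xi>\<in>U.
       (\<Sum>\<beta>\<in>UNIV. pd \<beta> (\<lambda>\<zeta>. \<rho> \<zeta> * sg \<zeta> * v \<zeta> $ \<beta>) \<xi>) + 2 * \<rho> \<xi> * sg \<xi> * V3 \<xi> = 0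
     \<and> (\<forall>\<alpha>. div21 g (\<lambda>\<zeta>. \<chi> \<alpha> \<beta>. sg \<zeta> * (\<rho> \<zeta> * v \<zeta> $ \<alpha> * v \<zeta> $ \<beta> - 1 / \<mu> * b \<zeta> $ \<alpha> * b \<zeta> $ \<beta>
                + matrix_inv (g \<zeta>) $ \<alpha> $ \<beta> * (p \<zeta> + BB \<zeta> / (2 * \<mu>)))) \<xi> \<alpha>
            + 3 * sg \<xi> * (\<rho> \<xi> * v \<xi> $ \<alpha> * V3 \<xi> - 1 / \<mu> * b \<xi> $ \<alpha> * B3 \<xi>)
            = - (sg \<xi> / \<mu>) * b \<xi> $ \<alpha> * dB \<xi>)
     \<and> (\<Sum>\<alpha>\<in>UNIV. pd \<alpha> (\<lambda>\<zeta>. \<rho> \<zeta> * sg \<zeta> * V3 \<zeta> * v \<zeta> $ \<alpha> - sg \<zeta> / \<mu> * B3 \<zeta> * b \<zeta> $ \<alpha>) \<xi>)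
         + 2 * sg \<xi> * (\<rho> \<xi> * (V3 \<xi>)\<^sup>2 - 1 / \<mu> * (B3 \<xi>)\<^sup>2)
         - \<rho> \<xi> * sg \<xi> * vv \<xi> + sg \<xi> / \<mu> * bb \<xi>
         = - (sg \<xi> / \<mu>) * B3 \<xi> * dB \<xi>
     \<and> (\<Sum>\<beta>\<in>UNIV. pd \<beta> (\<lambda>\<zeta>. sg \<zeta> * (h \<zeta> * v \<zeta> $ \<beta> - 1 / \<mu> * VB \<zeta> * b \<zeta> $ \<beta>)) \<xi>)
         + 2 * sg \<xi> * (h \<xi> * V3 \<xi> - 1 / \<mu> * VB \<xi> * B3 \<xi>)
         = - (sg \<xi> / \<mu>) * VB \<xi> * dB \<xi>
     \<and> (\<forall>\<alpha>. div20 g (\<lambda>\<zeta>. \<chi> \<alpha> \<beta>. v \<zeta> $ \<beta> * b \<zeta> $ \<alpha> - v \<zeta> $ \<alpha> * b \<zeta> $ \<beta>) \<xi> \<alpha>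
            + (V3 \<xi> * b \<xi> $ \<alpha> - v \<xi> $ \<alpha> * B3 \<xi>)
            = - v \<xi> $ \<alpha> * dB \<xi>)
     \<and> (\<Sum>\<beta>\<in>UNIV. pd \<beta> (\<lambda>\<zeta>. v \<zeta> $ \<beta> * B3 \<zeta> - V3 \<zeta> * b \<zeta> $ \<beta>) \<xi>)
         + (\<Sum>\<beta>\<in>UNIV. (v \<xi> $ \<beta> * B3 \<xi> - V3 \<xi> * b \<xi> $ \<beta>) * (1 / sg \<xi>) * pd \<beta> sg \<xi>)
         = - V3 \<xi> * dB \<xi>)"

end

theory Submission
  imports Defs
begin

text \<open>
  In the coordinates \<open>(\<xi>\<^sup>1, \<xi>\<^sup>2, r)\<close> the metric is \<open>dr\<^sup>2 + r\<^sup>2 g\<close>, so the only Christoffel symbols beyond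
  those of the sphere are \<open>\<Gamma>\<^sup>\<alpha>\<^sub>\<beta>\<^sub>3 = \<delta>\<^sup>\<alpha>\<^sub>\<beta> / r\<close> and \<open>\<Gamma>\<^sup>3\<^sub>\<alpha>\<^sub>\<beta> = - r g\<^sub>\<alpha>\<^sub>\<beta>\<close>.
  A conical field is constant along each ray as a vector of Euclidean space, hence its tangential
  components are homogeneous of degree \<open>-1\<close> in \<open>r\<close> and its radial component of degree \<open>0\<close>.
  Every flux is therefore a fixed power of \<open>r\<close> times a function on the sphere, and each equation
  on the cone equals the corresponding one on the sphere times a power of \<open>r\<close>.  In the radial
  momentum equation the pressure terms cancel, since \<open>g\<^sub>\<alpha>\<^sub>\<beta> g\<^sup>\<alpha>\<^sup>\<beta> = 2\<close>.
\<close>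

section \<open>Index bookkeeping between the sphere and the cone\<close>

text \<open>The inclusion of the Greek index range into the Latin one.\<close>

definition emb :: "2 \<Rightarrow> 3" where
  "emb \<alpha> = (if \<alpha> = 1 then 1 else 2)"

lemma emb_neq_3 [simp]: "emb \<alpha> \<noteq> 3" "3 \<noteq> emb \<alpha>"
  by (auto simp: emb_def)

lemma emb_eq_iff [simp]: "emb \<alpha> = emb \<beta> \<longleftrightarrow> \<alpha> = \<beta>"
  using exhaust_2[of \<alpha>] exhaust_2[of \<beta>] by (auto simp: emb_def)

text \<open>Splits Latin sums into a tangential block and a radial term, matching the block form of
  the metric; \<open>all_emb\<close> does the same for free indices.\<close>

lemma sum_emb: "(\<Sum>i\<in>UNIV. f i) = (\<Sum>\<alpha>\<in>UNIV. f (emb \<alpha>)) + f 3" for f :: "3 \<Rightarrow> 'a::comm_monoid_add"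
  by (simp add: sum_2 sum_3 emb_def)

lemma all_emb: "(\<forall>i. P i) \<longleftrightarrow> (\<forall>\<alpha>. P (emb \<alpha>)) \<and> P 3"
  by (simp add: forall_2 forall_3 emb_def)

lemma emb_cases: obtains \<alpha> where "i = emb \<alpha>" | "i = 3"
  by (metis emb_def exhaust_3 one_neq_zero zero_neq_one)

lemma vector_scale_nth: "vector [c * w $ 1, c * w $ 2] $ \<alpha> = c * w $ emb \<alpha>" for w :: "real^3"
  using exhaust_2[of \<alpha>] by (auto simp: emb_def)

lemma angular_nth [simp]: "angular y $ \<alpha> = y $ emb \<alpha>"
  using exhaust_2[of \<alpha>] by (auto simp: angular_def emb_def)

lemma coords_nth [simp]: "coords \<xi> t $ emb \<alpha> = \<xi> $ \<alpha>" "coords \<xi> t $ 3 = t"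
  using exhaust_2[of \<alpha>] by (auto simp: coords_def emb_def)

lemma angular_coords [simp]: "angular (coords \<xi> t) = \<xi>"
  by (simp add: vec_eq_iff)

lemma angular_add_axis [simp]:
  "angular (y + t *\<^sub>R axis (emb \<alpha>) 1) = angular y + t *\<^sub>R axis \<alpha> 1"
  "angular (y + t *\<^sub>R axis 3 1) = angular y"
  by (auto simp: vec_eq_iff axis_def)

lemma axis_nth_3 [simp]: "axis (emb \<alpha>) x $ 3 = 0" "axis 3 x $ 3 = x"
  by (simp_all add: axis_def)

lemma bounded_linear_angular: "bounded_linear angular"
  by (auto simp: linear_conv_bounded_linear[symmetric] vec_eq_iff intro!: linearI)

section \<open>Partial derivatives of products of a radial and an angular factor\<close>

text \<open>For small \<open>t\<close> the line \<open>y + t *\<^sub>R axis i 1\<close> stays in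
  \<open>S\<close>, so only values near \<open>y\<close> enter \<open>pd\<close>. This allows
  formulas that hold only on the chart to be differentiated.\<close>

lemma pd_cong:
  assumes "open S" "y \<in> S" and eq: "\<And>z. z \<in> S \<Longrightarrow> f z = g z"
  shows "pd i f y = pd i g y"
proof -
  have "((\<lambda>t. y + t *\<^sub>R axis i 1) \<longlongrightarrow> y) (nhds 0)"
    by (rule tendsto_eq_intros filterlim_ident | simp)+
  then have "eventually (\<lambda>t. y + t *\<^sub>R axis i 1 \<in> S) (nhds 0)"
    using assms topological_tendstoD by blast
  then have ev: "eventually (\<lambda>t. f (y + t *\<^sub>R axis i 1) = g (y + t *\<^sub>R axis i 1)) (nhds 0)"
    by eventually_elim (rule eq)
  show ?thesis
    unfolding pd_def by (rule vector_derivative_cong_eq) (use ev in \<open>auto elim: eventually_mono\<close>)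
qed

lemma has_vector_derivative_pd:
  assumes "f differentiable (at y)"
  shows "((\<lambda>t. f (y + t *\<^sub>R axis i 1)) has_vector_derivative pd i f y) (at 0)"
proof -
  have "(\<lambda>t. y + t *\<^sub>R axis i 1) differentiable (at 0)"
    by (simp add: differentiable_add differentiable_scaleR)
  then have "(f \<circ> (\<lambda>t. y + t *\<^sub>R axis i 1)) differentiable (at 0)"
    using assms by (intro differentiable_chain_at) auto
  then show ?thesis
    unfolding pd_def vector_derivative_works o_def .
qed

text \<open>Chain rule along a coordinate line. It links the partial derivatives in the metric to
  the Frechet derivatives whose regularity \<open>smooth_on\<close> controls.\<close>

lemma pd_eq_frechet_derivative:
  assumes "f differentiable (at y)"
  shows "pd i f y = frechet_derivative f (at y) (axis i 1)"
proof -
  have d: "(f has_derivative frechet_derivative f (at y)) (at (y + 0 *\<^sub>R axis i 1))"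
    using assms by (simp add: frechet_derivative_works)
  have l: "((\<lambda>t. y + t *\<^sub>R axis i 1) has_derivative (\<lambda>t. t *\<^sub>R axis i 1)) (at 0)"
    by (auto intro!: derivative_eq_intros)
  have "linear (frechet_derivative f (at y))"
    using assms by (rule linear_frechet_derivative)
  then have "((\<lambda>t. f (y + t *\<^sub>R axis i 1)) has_vector_derivative
      frechet_derivative f (at y) (axis i 1)) (at 0)"
    using has_derivative_compose[OF l d] unfolding has_vector_derivative_def
    by (simp add: linear_cmul)
  then show ?thesis
    unfolding pd_def by (rule vector_derivative_at)
qed

text \<open>Moving in an angular direction keeps \<open>y $ 3\<close> fixed, so the radial factor
  acts as a constant.\<close>

lemma pd_emb_scale:
  assumes "f differentiable (at (angular y))"
  shows "pd (emb \<alpha>) (\<lambda>z. c (z $ 3) *\<^sub>R f (angular z)) y = c (y $ 3) *\<^sub>R pd \<alpha> f (angular y)"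
proof -
  have "((\<lambda>t. c (y $ 3) *\<^sub>R f (angular y + t *\<^sub>R axis \<alpha> 1)) has_vector_derivative
      c (y $ 3) *\<^sub>R pd \<alpha> f (angular y)) (at 0)"
    by (rule has_vector_derivative_pd[OF assms, THEN bounded_linear.has_vector_derivative[OF bounded_linear_scaleR_right]])
  then show ?thesis
    unfolding pd_def[of "emb \<alpha>"] by (intro vector_derivative_at) simp
qed

text \<open>Moving radially keeps \<open>angular y\<close> fixed, so the angular factor acts as a
  constant.\<close>

lemma pd_3_scale:
  assumes "(c has_real_derivative d) (at (y $ 3))"
  shows "pd 3 (\<lambda>z. c (z $ 3) *\<^sub>R f (angular z)) y = d *\<^sub>R f (angular y)"
proof -
  have "((\<lambda>t. c (y $ 3 + t)) has_real_derivative d) (at 0)"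
    using assms by (simp add: DERIV_shift[of c d 0 "y $ 3", simplified] add.commute)
  then have "((\<lambda>t. c (y $ 3 + t) *\<^sub>R f (angular y)) has_vector_derivative d *\<^sub>R f (angular y)) (at 0)"
    by (auto intro!: derivative_eq_intros)
  then show ?thesis
    unfolding pd_def by (intro vector_derivative_at) simp
qed

section \<open>Matrix inverses and consequences of smoothness\<close>

lemma
  assumes "invertible A"
  shows matrix_inv_right: "A ** matrix_inv A = mat 1"
    and matrix_inv_left: "matrix_inv A ** A = mat 1"
  using someI_ex[OF assms[unfolded invertible_def]] by (simp_all add: matrix_inv_def)

text \<open>For square matrices a right inverse is also a left inverse, so \<open>A\<close> is
  invertible and \<open>A ** B = mat 1\<close> can be multiplied from the left by
  \<open>matrix_inv A\<close>.\<close>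

lemma matrix_inv_unique:
  fixes A B :: "real^'m^'m"
  assumes "A ** B = mat 1"
  shows "matrix_inv A = B"
proof -
  have "invertible A"
    using assms matrix_left_right_inverse unfolding invertible_def by blast
  then have "matrix_inv A ** (A ** B) = B"
    by (simp add: matrix_mul_assoc matrix_inv_left)
  then show ?thesis
    using assms by simp
qed

lemma smooth_on_differentiable:
  assumes "smooth_on S f" "x \<in> S"
  shows "f differentiable (at x)"
  using assms unfolding smooth_on_def by (metis Ck_on.simps(2))

lemma smooth_on_frechet_derivative_differentiable:
  assumes "smooth_on S f" "x \<in> S"
  shows "(\<lambda>x. frechet_derivative f (at x) v) differentiable (at x)"
  using assms unfolding smooth_on_def by (metis Ck_on.simps(2))

lemma differentiable_cong_open:
  assumes "f differentiable (at x)" "open S" "x \<in> S" "\<And>z. z \<in> S \<Longrightarrow> f z = g z"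
  shows "g differentiable (at x)"
  using assms unfolding differentiable_def
  by (metis has_derivative_transform_within_open)

section \<open>Geometry of the chart: the metric of the sphere\<close>

locale chart =
  fixes U :: "(real^2) set" and n :: "real^2 \<Rightarrow> real^3"
  assumes sphere_chart: "sphere_chart U n"
begin

abbreviation "D \<equiv> coord_domain U"
abbreviation "g \<equiv> metric_tensor n"
abbreviation "G \<equiv> metric_tensor (polar n)"

lemma open_U: "open U"
  using sphere_chart by (simp add: sphere_chart_def)

lemma domainD: "y \<in> D \<Longrightarrow> angular y \<in> U" "y \<in> D \<Longrightarrow> 0 < y $ 3"
  by (simp_all add: coord_domain_def)

lemma coords_domain [simp]: "coords \<xi> t \<in> D \<longleftrightarrow> \<xi> \<in> U \<and> 0 < t"
  by (simp add: coord_domain_def)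

lemma open_D: "open D"
proof -
  have "D = angular -` U \<inter> {y. 0 < y $ 3}"
    by (auto simp: coord_domain_def)
  moreover have "open (angular -` U)"
    using open_U bounded_linear_angular by (simp add: linear_continuous_on open_vimage)
  moreover have "open {y::real^3. 0 < y $ 3}"
    by (intro open_Collect_less continuous_intros)
  ultimately show ?thesis
    by auto
qed

lemma n_diff: "\<xi> \<in> U \<Longrightarrow> n differentiable (at \<xi>)"
  using sphere_chart smooth_on_differentiable by (auto simp: sphere_chart_def)

text \<open>Uses second order smoothness of \<open>n\<close>: the metric is built from its first
  partials, and the Christoffel symbols differentiate once more.\<close>

lemma pd_n_diff:
  assumes "\<xi> \<in> U"
  shows "pd \<alpha> n differentiable (at \<xi>)"
proof (rule differentiable_cong_open[OF _ open_U assms])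
  show "(\<lambda>\<xi>. frechet_derivative n (at \<xi>) (axis \<alpha> 1)) differentiable (at \<xi>)"
    using sphere_chart assms
    by (intro smooth_on_frechet_derivative_differentiable) (auto simp: sphere_chart_def)
qed (simp add: n_diff pd_eq_frechet_derivative)

lemma n_inner_n: "\<xi> \<in> U \<Longrightarrow> n \<xi> \<bullet> n \<xi> = 1"
  using sphere_chart by (auto simp: sphere_chart_def dot_square_norm)

text \<open>Differentiating the constant \<open>n \<zeta> \<bullet> n \<zeta>\<close> along a
  coordinate line gives twice this product.\<close>

lemma n_inner_pd_n:
  assumes "\<xi> \<in> U"
  shows "n \<xi> \<bullet> pd \<alpha> n \<xi> = 0"
proof -
  have d: "((\<lambda>t. n (\<xi> + t *\<^sub>R axis \<alpha> 1)) has_derivative (\<lambda>t. t *\<^sub>R pd \<alpha> n \<xi>)) (at 0)"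
    using has_vector_derivative_pd[OF n_diff[OF assms]] by (simp add: has_vector_derivative_def)
  have "((\<lambda>t. n (\<xi> + t *\<^sub>R axis \<alpha> 1) \<bullet> n (\<xi> + t *\<^sub>R axis \<alpha> 1)) has_vector_derivative
      2 * (n \<xi> \<bullet> pd \<alpha> n \<xi>)) (at 0)"
    unfolding has_vector_derivative_def
    by (rule has_derivative_eq_rhs[OF has_derivative_inner[OF d d]])
      (auto simp: inner_commute algebra_simps)
  then have "pd \<alpha> (\<lambda>\<zeta>. n \<zeta> \<bullet> n \<zeta>) \<xi> = 2 * (n \<xi> \<bullet> pd \<alpha> n \<xi>)"
    unfolding pd_def[of _ "\<lambda>\<zeta>. n \<zeta> \<bullet> n \<zeta>"] by (rule vector_derivative_at)
  moreover have "pd \<alpha> (\<lambda>\<zeta>. n \<zeta> \<bullet> n \<zeta>) \<xi> = pd \<alpha> (\<lambda>\<zeta>. 1::real) \<xi>"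
    by (rule pd_cong[OF open_U assms n_inner_n])
  ultimately show ?thesis
    by (simp add: pd_def)
qed

lemma g_nth: "g \<xi> $ \<alpha> $ \<beta> = pd \<alpha> n \<xi> \<bullet> pd \<beta> n \<xi>"
  by (simp add: metric_tensor_def)

lemma g_commute: "g \<xi> $ \<alpha> $ \<beta> = g \<xi> $ \<beta> $ \<alpha>"
  by (simp add: g_nth inner_commute)

lemma g_diff: "\<xi> \<in> U \<Longrightarrow> (\<lambda>\<zeta>. g \<zeta> $ \<alpha> $ \<beta>) differentiable (at \<xi>)"
  unfolding g_nth by (intro differentiable_inner pd_n_diff)

text \<open>This is the Gram determinant of the two partials of \<open>n\<close>, which are linearly
  independent because the Frechet derivative is injective.\<close>

lemma det_g_pos:
  assumes "\<xi> \<in> U"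
  shows "det (g \<xi>) > 0"
proof -
  define a b where "a = pd 1 n \<xi>" and "b = pd 2 n \<xi>"
  have lin: "linear (frechet_derivative n (at \<xi>))"
    using n_diff[OF assms] by (rule linear_frechet_derivative)
  have inj: "inj (frechet_derivative n (at \<xi>))"
    using sphere_chart assms by (simp add: sphere_chart_def)
  have indep: "s *\<^sub>R a + t *\<^sub>R b \<noteq> 0" if "s \<noteq> 0 \<or> t \<noteq> 0" for s t
  proof -
    let ?x = "s *\<^sub>R axis 1 1 + t *\<^sub>R axis 2 1 :: real^2"
    have "?x $ 1 = s" "?x $ 2 = t"
      by (simp_all add: axis_def)
    then have "?x \<noteq> 0"
      using that by (metis zero_index)
    then have "frechet_derivative n (at \<xi>) ?x \<noteq> 0"
      using inj lin by (metis injD linear_0)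
    then show ?thesis
      using lin n_diff[OF assms]
      by (simp add: a_def b_def pd_eq_frechet_derivative linear_add linear_cmul)
  qed
  have "b \<noteq> 0"
    using indep[of 0 1] by simp
  then have bb: "b \<bullet> b > 0"
    by simp
  \<comment> \<open>This vector is \<open>b \<bullet> b\<close> times the part of \<open>a\<close>
    orthogonal to \<open>b\<close>, that is, Gram-Schmidt without division. Its squared norm is
    \<open>b \<bullet> b\<close> times the Gram determinant.\<close>
  have "(b \<bullet> b) *\<^sub>R a + (- (a \<bullet> b)) *\<^sub>R b \<noteq> 0"
    using bb by (intro indep) auto
  then have "0 < ((b \<bullet> b) *\<^sub>R a + (- (a \<bullet> b)) *\<^sub>R b) \<bullet> ((b \<bullet> b) *\<^sub>R a + (- (a \<bullet> b)) *\<^sub>R b)"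
    using inner_gt_zero_iff by blast
  also have "\<dots> = (b \<bullet> b) * ((a \<bullet> a) * (b \<bullet> b) - (a \<bullet> b) * (a \<bullet> b))"
    by (simp add: inner_diff inner_commute algebra_simps)
  finally show ?thesis
    using bb by (simp add: zero_less_mult_iff det_2 g_nth a_def[symmetric] b_def[symmetric] inner_commute)
qed

text \<open>In the type \<open>2\<close>, \<open>3 - \<alpha>\<close> is the index other than \<open>\<alpha>\<close>.\<close>

lemma matrix_inv_g:
  assumes "\<xi> \<in> U"
  shows "matrix_inv (g \<xi>) =
    (\<chi> \<alpha> \<beta>. (if \<alpha> = \<beta> then g \<xi> $ (3 - \<alpha>) $ (3 - \<alpha>) else - g \<xi> $ \<alpha> $ \<beta>) / det (g \<xi>))"
proof (rule matrix_inv_unique)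
  have minus: "3 - 1 = (2::2)" "3 - 2 = (1::2)"
    by simp_all
  have "g \<xi> $ 1 $ 1 * g \<xi> $ 2 $ 2 / det (g \<xi>) - g \<xi> $ 1 $ 2 * g \<xi> $ 2 $ 1 / det (g \<xi>) = 1"
    using det_g_pos[OF assms] by (simp add: det_2 diff_divide_distrib[symmetric])
  then show "g \<xi> ** (\<chi> \<alpha> \<beta>. (if \<alpha> = \<beta> then g \<xi> $ (3 - \<alpha>) $ (3 - \<alpha>) else - g \<xi> $ \<alpha> $ \<beta>) / det (g \<xi>))
      = mat 1"
    by (simp add: vec_eq_iff forall_2 matrix_matrix_mult_def sum_2 mat_def minus mult.commute)
qed

lemma det_g_diff: "\<xi> \<in> U \<Longrightarrow> (\<lambda>\<zeta>. det (g \<zeta>)) differentiable (at \<xi>)"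
  unfolding det_2 by (intro differentiable_diff differentiable_mult g_diff)

lemma matrix_inv_g_diff: 
  assumes "\<xi> \<in> U"
  shows "(\<lambda>\<zeta>. matrix_inv (g \<zeta>) $ \<alpha> $ \<beta>) differentiable (at \<xi>)"
proof (rule differentiable_cong_open[OF _ open_U assms])
  show "(\<lambda>\<zeta>. (if \<alpha> = \<beta> then g \<zeta> $ (3 - \<alpha>) $ (3 - \<alpha>) else - g \<zeta> $ \<alpha> $ \<beta>) / det (g \<zeta>))
     differentiable (at \<xi>)"
    using det_g_pos[OF assms] g_diff[OF assms] det_g_diff[OF assms]
    by (cases "\<alpha> = \<beta>") (auto intro!: differentiable_divide differentiable_minus)
qed (simp add: matrix_inv_g)

lemma sqrt_det_g_diff:
  assumes "\<xi> \<in> U"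
  shows "(\<lambda>\<zeta>. sqrt (det (g \<zeta>))) differentiable (at \<xi>)"
proof -
  have "sqrt differentiable (at (det (g \<xi>)))"
    using DERIV_real_sqrt[OF det_g_pos[OF assms]] real_differentiable_def by blast
  then show ?thesis
    using differentiable_chain_at[OF det_g_diff[OF assms]] by (simp add: o_def)
qed

lemma g_inv: "\<xi> \<in> U \<Longrightarrow> (\<Sum>\<nu>\<in>UNIV. g \<xi> $ \<alpha> $ \<nu> * matrix_inv (g \<xi>) $ \<nu> $ \<beta>) = (if \<alpha> = \<beta> then 1 else 0)"
  using matrix_inv_right[of "g \<xi>"] det_g_pos[of \<xi>]
  by (auto simp: invertible_det_nz vec_eq_iff matrix_matrix_mult_def mat_def)

lemma inv_g: "\<xi> \<in> U \<Longrightarrow> (\<Sum>\<nu>\<in>UNIV. matrix_inv (g \<xi>) $ \<alpha> $ \<nu> * g \<xi> $ \<nu> $ \<beta>) = (if \<alpha> = \<beta> then 1 else 0)"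
  using matrix_inv_left[of "g \<xi>"] det_g_pos[of \<xi>]
  by (auto simp: invertible_det_nz vec_eq_iff matrix_matrix_mult_def mat_def)

lemma inv_g_commute: "\<xi> \<in> U \<Longrightarrow> matrix_inv (g \<xi>) $ \<alpha> $ \<beta> = matrix_inv (g \<xi>) $ \<beta> $ \<alpha>"
  by (auto simp: matrix_inv_g g_commute)

section \<open>The metric and the Christoffel symbols in cone coordinates\<close>

lemma pd_polar:
  assumes "y \<in> D"
  shows "pd (emb \<alpha>) (polar n) y = y $ 3 *\<^sub>R pd \<alpha> n (angular y)" "pd 3 (polar n) y = n (angular y)"
  using pd_emb_scale[of n y \<alpha> "\<lambda>t. t"] pd_3_scale[of "\<lambda>t. t" 1 y n] n_diff domainD[OF assms]
  by (simp_all add: polar_def[abs_def])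

text \<open>The angular coordinate vectors are \<open>y $ 3\<close> times those of the sphere; the
  radial one is the unit normal \<open>n\<close>, orthogonal to them.\<close>

lemma G_nth:
  assumes "y \<in> D"
  shows "G y $ emb \<alpha> $ emb \<beta> = (y $ 3)\<^sup>2 * g (angular y) $ \<alpha> $ \<beta>" "G y $ emb \<alpha> $ 3 = 0"
    "G y $ 3 $ emb \<alpha> = 0" "G y $ 3 $ 3 = 1"
  using domainD[OF assms]
  by (simp_all add: metric_tensor_def pd_polar[OF assms] power2_eq_square n_inner_n n_inner_pd_n
      inner_commute[of "pd _ _ _" "n _"])

lemma det_G:
  assumes "y \<in> D"
  shows "det (G y) = (y $ 3)^4 * det (g (angular y))"
proof -
  have emb: "emb 1 = 1" "emb 2 = 2" by (simp_all add: emb_def)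
  show ?thesis
    using G_nth(1)[OF assms, of 1 1] G_nth(1)[OF assms, of 1 2] G_nth(1)[OF assms, of 2 1]
      G_nth(1)[OF assms, of 2 2] G_nth(2,3)[OF assms, of 1] G_nth(2,3)[OF assms, of 2] G_nth(4)[OF assms]
    unfolding emb by (simp add: det_3 det_2 algebra_simps power2_eq_square power4_eq_xxxx)
qed

lemma sqrt_det_G:
  assumes "y \<in> D"
  shows "sqrt (det (G y)) = (y $ 3)\<^sup>2 * sqrt (det (g (angular y)))"
proof -
  have "sqrt ((y $ 3)^4) = (y $ 3)\<^sup>2"
    using real_sqrt_abs[of "(y $ 3)\<^sup>2"] by simp
  then show ?thesis
    unfolding det_G[OF assms] real_sqrt_mult by simp
qed

lemma matrix_inv_G:
  assumes "y \<in> D"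
  shows "matrix_inv (G y) $ emb \<alpha> $ emb \<beta> = matrix_inv (g (angular y)) $ \<alpha> $ \<beta> / (y $ 3)\<^sup>2"
    "matrix_inv (G y) $ emb \<alpha> $ 3 = 0"
    "matrix_inv (G y) $ 3 $ emb \<alpha> = 0" "matrix_inv (G y) $ 3 $ 3 = 1"
proof -
  \<comment> \<open>A left inverse of \<open>emb\<close>. Its value at \<open>3\<close> is a dummy,
    since \<open>H\<close> consults \<open>up\<close> only when neither index is
    \<open>3\<close>.\<close>
  define up where "up i = (if i = 1 then 1 else 2 :: 2)" for i :: 3
  have up: "up (emb \<alpha>) = \<alpha>" for \<alpha>
    using exhaust_2[of \<alpha>] by (auto simp: up_def emb_def)
  define H where "H = (\<chi> i j. if i = 3 \<or> j = 3 then (if i = j then 1 else 0)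
      else matrix_inv (g (angular y)) $ up i $ up j / (y $ 3)\<^sup>2)"
  have "G y ** H = mat 1"
    using domainD[OF assms] g_inv[of "angular y"]
    unfolding vec_eq_iff all_emb
    by (simp add: matrix_matrix_mult_def sum_emb mat_def G_nth[OF assms] H_def up)
  then have "matrix_inv (G y) = H"
    by (rule matrix_inv_unique)
  then show "matrix_inv (G y) $ emb \<alpha> $ emb \<beta> = matrix_inv (g (angular y)) $ \<alpha> $ \<beta> / (y $ 3)\<^sup>2"
    "matrix_inv (G y) $ emb \<alpha> $ 3 = 0"
    "matrix_inv (G y) $ 3 $ emb \<alpha> = 0" "matrix_inv (G y) $ 3 $ 3 = 1"
    by (simp_all add: H_def up)
qed

text \<open>Working form of \<open>pd_emb_scale\<close>: the factorisation is asked for only on the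
  open set \<open>D\<close>, where the formulas for \<open>G\<close> and its inverse hold.
  \<open>pd_3_eqI\<close> is the radial counterpart.\<close>

lemma pd_emb_eqI:
  fixes f :: "real^2 \<Rightarrow> real"
  assumes "y \<in> D" "f differentiable (at (angular y))" "\<And>z. z \<in> D \<Longrightarrow> F z = c (z $ 3) * f (angular z)"
  shows "pd (emb \<alpha>) F y = c (y $ 3) * pd \<alpha> f (angular y)"
proof -
  have "pd (emb \<alpha>) F y = pd (emb \<alpha>) (\<lambda>z. c (z $ 3) *\<^sub>R f (angular z)) y"
    by (rule pd_cong[OF open_D]) (auto simp: assms)
  with pd_emb_scale[OF assms(2), of \<alpha> c] show ?thesis by simp
qed

lemma pd_3_eqI:
  fixes f :: "real^2 \<Rightarrow> real"
  assumes "y \<in> D" "(c has_real_derivative d) (at (y $ 3))" "\<And>z. z \<in> D \<Longrightarrow> F z = c (z $ 3) * f (angular z)"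
  shows "pd 3 F y = d * f (angular y)"
proof -
  have "pd 3 F y = pd 3 (\<lambda>z. c (z $ 3) *\<^sub>R f (angular z)) y"
    by (rule pd_cong[OF open_D]) (auto simp: assms)
  with pd_3_scale[OF assms(2), of f] show ?thesis by simp
qed

lemma pd_G:
  assumes y: "y \<in> D"
  shows "pd (emb \<gamma>) (\<lambda>z. G z $ emb \<alpha> $ emb \<beta>) y = (y $ 3)\<^sup>2 * pd \<gamma> (\<lambda>\<zeta>. g \<zeta> $ \<alpha> $ \<beta>) (angular y)"
    "pd 3 (\<lambda>z. G z $ emb \<alpha> $ emb \<beta>) y = 2 * y $ 3 * g (angular y) $ \<alpha> $ \<beta>"
    "pd i (\<lambda>z. G z $ emb \<alpha> $ 3) y = 0" "pd i (\<lambda>z. G z $ 3 $ emb \<alpha>) y = 0"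
    "pd i (\<lambda>z. G z $ 3 $ 3) y = 0"
proof -
  show "pd (emb \<gamma>) (\<lambda>z. G z $ emb \<alpha> $ emb \<beta>) y = (y $ 3)\<^sup>2 * pd \<gamma> (\<lambda>\<zeta>. g \<zeta> $ \<alpha> $ \<beta>) (angular y)"
    by (rule pd_emb_eqI[OF y g_diff[OF domainD(1)[OF y]]]) (simp add: G_nth)
  show "pd 3 (\<lambda>z. G z $ emb \<alpha> $ emb \<beta>) y = 2 * y $ 3 * g (angular y) $ \<alpha> $ \<beta>"
    by (rule pd_3_eqI[OF y, of "\<lambda>t. t\<^sup>2"]) (auto simp: G_nth intro!: derivative_eq_intros)
  have c: "pd i F y = 0" if "\<And>z. z \<in> D \<Longrightarrow> F z = c" for F and c :: real
    using pd_cong[OF open_D y, of F "\<lambda>_. c" i] that by (simp add: pd_def)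
  show "pd i (\<lambda>z. G z $ emb \<alpha> $ 3) y = 0" "pd i (\<lambda>z. G z $ 3 $ emb \<alpha>) y = 0"
    "pd i (\<lambda>z. G z $ 3 $ 3) y = 0"
    by (rule c, erule G_nth)+
qed

lemma christoffel_G:
  assumes y: "y \<in> D"
  shows "christoffel G y (emb \<alpha>) (emb \<beta>) (emb \<gamma>) = christoffel g (angular y) \<alpha> \<beta> \<gamma>"
    "christoffel G y (emb \<alpha>) (emb \<beta>) 3 = (if \<alpha> = \<beta> then 1 / y $ 3 else 0)"
    "christoffel G y (emb \<alpha>) 3 (emb \<beta>) = (if \<alpha> = \<beta> then 1 / y $ 3 else 0)"
    "christoffel G y (emb \<alpha>) 3 3 = 0"
    "christoffel G y 3 (emb \<alpha>) (emb \<beta>) = - y $ 3 * g (angular y) $ \<alpha> $ \<beta>"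
    "christoffel G y 3 (emb \<alpha>) 3 = 0"
    "christoffel G y 3 3 (emb \<alpha>) = 0"
    "christoffel G y 3 3 3 = 0"
proof -
  note r = domainD(2)[OF y]
  note simps = christoffel_def sum_emb matrix_inv_G[OF y] pd_G[OF y]
  show "christoffel G y (emb \<alpha>) (emb \<beta>) (emb \<gamma>) = christoffel g (angular y) \<alpha> \<beta> \<gamma>"
    using r unfolding simps by (auto simp: field_simps intro!: sum.cong)
  \<comment> \<open>With \<open>r = y $ 3\<close>, the radial derivative of \<open>r^2 g\<close> is
    \<open>2 r g\<close>; contracting half of it with the inverse metric, which carries
    \<open>1 / r^2\<close>, leaves \<open>1 / r\<close> on the diagonal.\<close>
  have *: "(\<Sum>l\<in>UNIV. matrix_inv (g (angular y)) $ \<alpha> $ l / (y $ 3)\<^sup>2 * (2 * y $ 3 * g (angular y) $ l $ \<beta>)) / 2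
      = (if \<alpha> = \<beta> then 1 / y $ 3 else 0)"
  proof -
    have "(\<Sum>l\<in>UNIV. matrix_inv (g (angular y)) $ \<alpha> $ l / (y $ 3)\<^sup>2 * (2 * y $ 3 * g (angular y) $ l $ \<beta>)) / 2
      = (\<Sum>l\<in>UNIV. matrix_inv (g (angular y)) $ \<alpha> $ l * g (angular y) $ l $ \<beta>) / y $ 3"
      using r by (simp add: sum_divide_distrib power2_eq_square)
    then show ?thesis
      by (simp add: inv_g domainD[OF y])
  qed
  show "christoffel G y (emb \<alpha>) (emb \<beta>) 3 = (if \<alpha> = \<beta> then 1 / y $ 3 else 0)"
    "christoffel G y (emb \<alpha>) 3 (emb \<beta>) = (if \<alpha> = \<beta> then 1 / y $ 3 else 0)"
    using * unfolding simps by simp_all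
  show "christoffel G y (emb \<alpha>) 3 3 = 0"
    "christoffel G y 3 (emb \<alpha>) (emb \<beta>) = - y $ 3 * g (angular y) $ \<alpha> $ \<beta>"
    "christoffel G y 3 (emb \<alpha>) 3 = 0"
    "christoffel G y 3 3 (emb \<alpha>) = 0"
    "christoffel G y 3 3 3 = 0"
    unfolding simps by simp_all
qed

text \<open>Jacobi's formula for the derivative of a determinant, computed by hand in dimension two.
  It produces the explicit derivative of \<open>sqrt (det g)\<close> in the radial induction
  equation.\<close>

lemma christoffel_trace_g:
  assumes "\<xi> \<in> U"
  shows "(\<Sum>\<nu>\<in>UNIV. christoffel g \<xi> \<nu> \<beta> \<nu>)
    = pd \<beta> (\<lambda>\<zeta>. sqrt (det (g \<zeta>))) \<xi> / sqrt (det (g \<xi>))"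
proof -
  define d where "d \<mu> \<nu> = pd \<beta> (\<lambda>\<zeta>. g \<zeta> $ \<mu> $ \<nu>) \<xi>" for \<mu> \<nu>
  have pos: "det (g \<xi>) > 0"
    using assms by (rule det_g_pos)
  have comm: "pd \<gamma> (\<lambda>\<zeta>. g \<zeta> $ 2 $ 1) \<xi> = pd \<gamma> (\<lambda>\<zeta>. g \<zeta> $ 1 $ 2) \<xi>" for \<gamma>
    by (simp add: g_commute)
  have deriv: "((\<lambda>t. g (\<xi> + t *\<^sub>R axis \<beta> 1) $ \<mu> $ \<nu>) has_real_derivative d \<mu> \<nu>) (at 0)" for \<mu> \<nu>
    unfolding d_def has_real_derivative_iff_has_vector_derivative
    by (rule has_vector_derivative_pd[OF g_diff[OF assms]])
  \<comment> \<open>The derivative of the determinant along the coordinate line, with the two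
    off-diagonal contributions merged by the symmetry of \<open>g\<close>.\<close>
  define e where "e = d 1 1 * g \<xi> $ 2 $ 2 + g \<xi> $ 1 $ 1 * d 2 2 - 2 * (g \<xi> $ 1 $ 2 * d 1 2)"
  have "((\<lambda>t. det (g (\<xi> + t *\<^sub>R axis \<beta> 1))) has_real_derivative e) (at 0)"
    unfolding det_2
    by (rule derivative_eq_intros deriv refl)+
      (simp add: e_def d_def comm g_commute[of \<xi> 2 1] algebra_simps)
  then have "((\<lambda>t. sqrt (det (g (\<xi> + t *\<^sub>R axis \<beta> 1)))) has_real_derivative e / (2 * sqrt (det (g \<xi>)))) (at 0)"
    using pos by (auto intro!: derivative_eq_intros simp: field_simps)
  then have sqrt: "pd \<beta> (\<lambda>\<zeta>. sqrt (det (g \<zeta>))) \<xi> = e / (2 * sqrt (det (g \<xi>)))"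
    unfolding pd_def has_real_derivative_iff_has_vector_derivative by (rule vector_derivative_at)
  have minus: "3 - 1 = (2::2)" "3 - 2 = (1::2)"
    by simp_all
  have "(\<Sum>\<nu>\<in>UNIV. christoffel g \<xi> \<nu> \<beta> \<nu>) = e / (2 * det (g \<xi>))"
    using exhaust_2[of \<beta>] pos
    by (auto simp: christoffel_def sum_2 matrix_inv_g[OF assms] minus e_def d_def comm
        g_commute[of \<xi> 2 1] field_simps)
  then show ?thesis
    using pos by (simp add: sqrt)
qed

section \<open>Dual frame and contravariant components\<close>

text \<open>The basis of the tangent plane dual to the coordinate one, so that \<open>x \<bullet> dual \<alpha> \<xi>\<close> is the
  contravariant component of \<open>x\<close>.\<close>

definition dual :: "2 \<Rightarrow> real^2 \<Rightarrow> real^3" where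
  "dual \<alpha> \<xi> = (\<Sum>\<beta>\<in>UNIV. matrix_inv (g \<xi>) $ \<alpha> $ \<beta> *\<^sub>R pd \<beta> n \<xi>)"

lemma dual_diff:
  assumes "\<xi> \<in> U"
  shows "dual \<alpha> differentiable (at \<xi>)"
  unfolding dual_def[abs_def]
  by (rule differentiable_sum) (auto intro!: differentiable_scaleR matrix_inv_g_diff pd_n_diff assms)

lemma dual_inner:
  assumes "\<xi> \<in> U"
  shows "pd \<beta> n \<xi> \<bullet> dual \<alpha> \<xi> = (if \<alpha> = \<beta> then 1 else 0)" "n \<xi> \<bullet> dual \<alpha> \<xi> = 0"
  using inv_g[OF assms, of \<alpha> \<beta>] n_inner_pd_n[OF assms]
  by (simp_all add: dual_def inner_sum_right g_nth g_commute inner_commute)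

text \<open>With the coordinate vectors as rows of \<open>A\<close>, the product of \<open>A\<close>
  and its transpose is \<open>G y\<close>. Hence \<open>A\<close> is invertible, and
  \<open>u\<close> lies in its trivial kernel.\<close>

lemma orthogonal_frame_eq_0:
  assumes "y \<in> D" and orth: "\<And>i. pd i (polar n) y \<bullet> u = 0"
  shows "u = 0"
proof -
  define A where "A = (\<chi> i. pd i (polar n) y)"
  have "A ** transpose A = G y"
    by (simp add: A_def vec_eq_iff matrix_matrix_mult_def transpose_def metric_tensor_def inner_vec_def)
  then have "det A * det A = det (G y)"
    by (metis det_mul det_transpose)
  then have "invertible A"
    using domainD(2)[OF assms(1)] det_g_pos[OF domainD(1)[OF assms(1)]]
    by (auto simp: invertible_det_nz det_G[OF assms(1)])
  moreover have "A *v u = 0"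
    using orth by (simp add: A_def vec_eq_iff matrix_vector_mult_def inner_vec_def)
  ultimately show ?thesis
    by (metis matrix_left_invertible_ker invertible_def)
qed

text \<open>The difference of the two sides is orthogonal to every coordinate vector, by
  \<open>g_inv\<close> and because \<open>n\<close> is a unit normal.\<close>

lemma frame_expansion:
  assumes "\<xi> \<in> U"
  shows "x = (\<Sum>\<alpha>\<in>UNIV. (x \<bullet> dual \<alpha> \<xi>) *\<^sub>R pd \<alpha> n \<xi>) + (x \<bullet> n \<xi>) *\<^sub>R n \<xi>" (is "x = ?x")
proof -
  \<comment> \<open>At radius \<open>1\<close> the coordinate vectors of \<open>polar n\<close> are
    exactly the partials of \<open>n\<close> and \<open>n\<close> itself.\<close>
  have D: "coords \<xi> 1 \<in> D"
    using assms by simp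
  have "pd i (polar n) (coords \<xi> 1) \<bullet> (x - ?x) = 0" for i
  proof (cases i rule: emb_cases)
    case (1 \<beta>)
    have "(\<Sum>\<alpha>\<in>UNIV. (x \<bullet> dual \<alpha> \<xi>) * g \<xi> $ \<beta> $ \<alpha>)
        = (\<Sum>\<alpha>\<in>UNIV. \<Sum>\<nu>\<in>UNIV. g \<xi> $ \<beta> $ \<alpha> * matrix_inv (g \<xi>) $ \<alpha> $ \<nu> * (x \<bullet> pd \<nu> n \<xi>))"
      by (simp add: dual_def inner_sum_right sum_distrib_left sum_distrib_right ac_simps)
    also have "\<dots> = (\<Sum>\<nu>\<in>UNIV. (\<Sum>\<alpha>\<in>UNIV. g \<xi> $ \<beta> $ \<alpha> * matrix_inv (g \<xi>) $ \<alpha> $ \<nu>) * (x \<bullet> pd \<nu> n \<xi>))"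
      by (subst sum.swap) (simp add: sum_distrib_right)
    also have "\<dots> = x \<bullet> pd \<beta> n \<xi>"
      by (simp add: g_inv[OF assms] mult_delta_left)
    finally show ?thesis
      using n_inner_pd_n[OF assms]
      by (simp add: 1 pd_polar[OF D] inner_diff_right inner_add_right inner_sum_right g_nth inner_commute)
  next
    case 2
    then show ?thesis
      using n_inner_pd_n[OF assms] n_inner_n[OF assms]
      by (simp add: pd_polar[OF D] inner_diff_right inner_add_right inner_sum_right inner_commute)
  qed
  then show ?thesis
    using orthogonal_frame_eq_0[OF D] by fastforce
qed

text \<open>As \<open>contravariant\<close> is a definite description, existence and uniqueness are
  both due: \<open>frame_expansion\<close> provides components, and pairing with \<open>dual\<close>
  and \<open>n\<close> forces them. The divisor \<open>y $ 3\<close> undoes the scaling of the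
  angular coordinate vectors.\<close>

lemma contravariant_polar:
  assumes y: "y \<in> D"
  shows "contravariant (polar n) W y $ emb \<alpha> = (W (polar n y) \<bullet> dual \<alpha> (angular y)) / y $ 3"
    "contravariant (polar n) W y $ 3 = W (polar n y) \<bullet> n (angular y)"
proof -
  note \<xi> = domainD(1)[OF y] and r = domainD(2)[OF y]
  let ?P = "\<lambda>w. W (polar n y) = (\<Sum>i\<in>UNIV. w $ i *\<^sub>R pd i (polar n) y)"
  have comp: "w $ emb \<alpha> = (W (polar n y) \<bullet> dual \<alpha> (angular y)) / y $ 3"
    "w $ 3 = W (polar n y) \<bullet> n (angular y)" if "?P w" for w \<alpha>
    using r unfolding that
    by (simp_all add: sum_emb pd_polar[OF y] inner_add_left inner_sum_left dual_inner[OF \<xi>]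
        n_inner_n[OF \<xi>] n_inner_pd_n[OF \<xi>] inner_commute[of "pd _ _ _" "n _"]
        mult_delta_right)
  define w where "w = coords (\<chi> \<alpha>. (W (polar n y) \<bullet> dual \<alpha> (angular y)) / y $ 3) (W (polar n y) \<bullet> n (angular y))"
  have "?P w"
    using r frame_expansion[OF \<xi>, of "W (polar n y)"] by (simp add: w_def sum_emb pd_polar[OF y])
  moreover have "w' = w" if "?P w'" for w'
    unfolding vec_eq_iff all_emb using comp[OF that] comp[OF \<open>?P w\<close>] by simp
  ultimately have "?P (contravariant (polar n) W y)"
    unfolding contravariant_def by (rule theI)
  then show "contravariant (polar n) W y $ emb \<alpha> = (W (polar n y) \<bullet> dual \<alpha> (angular y)) / y $ 3"
    "contravariant (polar n) W y $ 3 = W (polar n y) \<bullet> n (angular y)"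
    by (rule comp)+
qed

section \<open>Conical fields are constant along rays\<close>

lemma polar_coords [simp]: "polar n (coords \<xi> t) = t *\<^sub>R n \<xi>"
  by (simp add: polar_def)

lemma scaleR_n_cone [simp]: "\<xi> \<in> U \<Longrightarrow> 0 < t \<Longrightarrow> t *\<^sub>R n \<xi> \<in> cone_region U n"
  unfolding cone_region_def by (metis coords_domain image_eqI polar_coords)

lemma polar_cone: "y \<in> D \<Longrightarrow> polar n y \<in> cone_region U n"
  by (simp add: cone_region_def)

text \<open>Radial derivative of a function described along a single ray, for use before its
  dependence on the radius has been found.\<close>

lemma pd_3_curve:
  assumes y: "y \<in> D" and F: "\<And>t. t > 0 \<Longrightarrow> F (coords (angular y) t) = f t"
    and f: "(f has_real_derivative d) (at (y $ 3))"
  shows "pd 3 F y = d"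
proof -
  have "y + t *\<^sub>R axis 3 1 = coords (angular y) (y $ 3 + t)" for t
    unfolding vec_eq_iff all_emb by (simp add: axis_def)
  moreover have "((\<lambda>t. F (coords (angular y) t)) has_real_derivative d) (at (y $ 3))"
    using has_field_derivative_transform_within_open[OF f open_greaterThan[of 0]] domainD(2)[OF y] F
    by auto
  then have "((\<lambda>t. F (coords (angular y) (y $ 3 + t))) has_real_derivative d) (at 0)"
    using DERIV_shift[of "\<lambda>t. F (coords (angular y) t)" d 0 "y $ 3"] by (simp add: add.commute)
  ultimately show ?thesis
    unfolding pd_def
    by (intro vector_derivative_at) (simp add: has_real_derivative_iff_has_vector_derivative)
qed

lemma ray_diff:
  assumes "smooth_on (cone_region U n) f" "\<xi> \<in> U" "0 < t"
  shows "(\<lambda>t. f (t *\<^sub>R n \<xi>)) differentiable (at t)"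
proof -
  have "(\<lambda>t. t *\<^sub>R n \<xi>) differentiable (at t)"
    by (simp add: differentiable_scaleR)
  moreover have "f differentiable (at (t *\<^sub>R n \<xi>))"
    using assms by (intro smooth_on_differentiable) auto
  ultimately show ?thesis
    using differentiable_chain_at[of "\<lambda>t. t *\<^sub>R n \<xi>" t f] by (simp add: o_def)
qed

lemma surface_diff:
  assumes "smooth_on (cone_region U n) f" "\<xi> \<in> U" "0 < t"
  shows "(\<lambda>\<xi>. f (t *\<^sub>R n \<xi>)) differentiable (at \<xi>)"
proof -
  have "(\<lambda>\<xi>. t *\<^sub>R n \<xi>) differentiable (at \<xi>)"
    using n_diff[OF assms(2)] by (simp add: differentiable_scaleR)
  moreover have "f differentiable (at (t *\<^sub>R n \<xi>))"
    using assms by (intro smooth_on_differentiable) auto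
  ultimately show ?thesis
    using differentiable_chain_at[of "\<lambda>\<xi>. t *\<^sub>R n \<xi>" \<xi> f] by (simp add: o_def)
qed

lemma constant_on_ray:
  fixes f :: "real \<Rightarrow> real"
  assumes "\<And>t. t > 0 \<Longrightarrow> (f has_real_derivative 0) (at t)" "s > 0" "t > 0"
  shows "f s = f t"
proof -
  have "\<exists>c. \<forall>x\<in>{0<..}. f x = c"
    by (rule has_field_derivative_zero_constant)
      (auto intro: has_field_derivative_at_within assms(1))
  with assms(2,3) show ?thesis
    by auto
qed

text \<open>The value of \<open>pd\<close> is the derivative only where one exists. Smoothness
  supplies existence, and the derivative along the ray is then zero.\<close>

lemma conical_scalar_ray:
  assumes smooth: "smooth_on (cone_region U n) f" and "conical_scalar U n f"
    and \<xi>: "\<xi> \<in> U" and "s > 0" "t > 0"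
  shows "f (s *\<^sub>R n \<xi>) = f (t *\<^sub>R n \<xi>)"
proof (rule constant_on_ray[of "\<lambda>t. f (t *\<^sub>R n \<xi>)"])
  fix t :: real assume t: "t > 0"
  obtain d where d: "((\<lambda>t. f (t *\<^sub>R n \<xi>)) has_real_derivative d) (at t)"
    using ray_diff[OF smooth \<xi> t] real_differentiable_def by blast
  have y: "coords \<xi> t \<in> D"
    using \<xi> t by simp
  have "pd 3 (\<lambda>z. f (polar n z)) (coords \<xi> t) = d"
    using y d by (intro pd_3_curve[where f = "\<lambda>t. f (t *\<^sub>R n \<xi>)"]) simp_all
  then show "((\<lambda>t. f (t *\<^sub>R n \<xi>)) has_real_derivative 0) (at t)"
    using d y assms(2) by (simp add: conical_scalar_def)
qed fact+

text \<open>For a tangential component \<open>a = W \<bullet> dual \<alpha> \<xi>\<close> the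
  conical condition reads \<open>(a / t)' + a / t^2 = a' / t = 0\<close>, the second term coming
  from the Christoffel symbol \<open>1 / t\<close>. In the radial equation no Christoffel symbol
  contributes. So all components are constant, and the frame is fixed along the ray.\<close>

lemma conical_vector_ray:
  assumes smooth: "smooth_on (cone_region U n) W" and conical: "conical_vector U n W"
    and \<xi>: "\<xi> \<in> U" and "s > 0" "t > 0"
  shows "W (s *\<^sub>R n \<xi>) = W (t *\<^sub>R n \<xi>)"
proof -
  have deriv: "\<exists>d. ((\<lambda>t. W (t *\<^sub>R n \<xi>) \<bullet> x) has_real_derivative d) (at t)" if "t > 0" for t x
  proof -
    have "(\<lambda>t. W (t *\<^sub>R n \<xi>) \<bullet> x) differentiable (at t)"
      using ray_diff[OF smooth \<xi> that] by (intro differentiable_inner) simp_all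
    then show ?thesis
      using real_differentiable_def by blast
  qed
  have cov: "cov_deriv G (contravariant (polar n) W) (coords \<xi> t) i 3 = 0" if "t > 0" for t i
    using conical that \<xi> by (simp add: conical_vector_def)
  have "W (s *\<^sub>R n \<xi>) \<bullet> dual \<alpha> \<xi> = W (t *\<^sub>R n \<xi>) \<bullet> dual \<alpha> \<xi>" for \<alpha>
  proof (rule constant_on_ray[of "\<lambda>t. W (t *\<^sub>R n \<xi>) \<bullet> dual \<alpha> \<xi>"])
    fix t :: real assume t: "t > 0"
    obtain d where d: "((\<lambda>t. W (t *\<^sub>R n \<xi>) \<bullet> dual \<alpha> \<xi>) has_real_derivative d) (at t)"
      using deriv[OF t] by blast
    have y: "coords \<xi> t \<in> D"
      using \<xi> t by simp
    have "pd 3 (\<lambda>z. contravariant (polar n) W z $ emb \<alpha>) (coords \<xi> t)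
        = (d * t - W (t *\<^sub>R n \<xi>) \<bullet> dual \<alpha> \<xi>) / (t * t)"
      using y d t \<xi>
      by (intro pd_3_curve[where f = "\<lambda>t. (W (t *\<^sub>R n \<xi>) \<bullet> dual \<alpha> \<xi>) / t"])
        (auto simp: contravariant_polar intro!: derivative_eq_intros)
    moreover have "pd 3 (\<lambda>z. contravariant (polar n) W z $ emb \<alpha>) (coords \<xi> t)
        + 1 / t * ((W (t *\<^sub>R n \<xi>) \<bullet> dual \<alpha> \<xi>) / t) = 0"
      using cov[OF t, of "emb \<alpha>"]
      by (simp add: cov_deriv_def sum_emb christoffel_G[OF y] contravariant_polar[OF y]
          mult_delta_left sum_divide_distrib[symmetric])
    ultimately have "d = 0"
      using t by (simp add: field_simps)
    with d show "((\<lambda>t. W (t *\<^sub>R n \<xi>) \<bullet> dual \<alpha> \<xi>) has_real_derivative 0) (at t)"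
      by simp
  qed fact+
  moreover have "W (s *\<^sub>R n \<xi>) \<bullet> n \<xi> = W (t *\<^sub>R n \<xi>) \<bullet> n \<xi>"
  proof (rule constant_on_ray[of "\<lambda>t. W (t *\<^sub>R n \<xi>) \<bullet> n \<xi>"])
    fix t :: real assume t: "t > 0"
    obtain d where d: "((\<lambda>t. W (t *\<^sub>R n \<xi>) \<bullet> n \<xi>) has_real_derivative d) (at t)"
      using deriv[OF t] by blast
    have y: "coords \<xi> t \<in> D"
      using \<xi> t by simp
    have "pd 3 (\<lambda>z. contravariant (polar n) W z $ 3) (coords \<xi> t) = d"
      using y d t \<xi>
      by (intro pd_3_curve[where f = "\<lambda>t. W (t *\<^sub>R n \<xi>) \<bullet> n \<xi>"])
        (auto simp: contravariant_polar)
    then have "d = 0"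
      using cov[OF t, of 3] by (simp add: cov_deriv_def sum_emb christoffel_G[OF y])
    with d show "((\<lambda>t. W (t *\<^sub>R n \<xi>) \<bullet> n \<xi>) has_real_derivative 0) (at t)"
      by simp
  qed fact+
  ultimately show ?thesis
    using frame_expansion[OF \<xi>, of "W (s *\<^sub>R n \<xi>)"] frame_expansion[OF \<xi>, of "W (t *\<^sub>R n \<xi>)"]
    by simp
qed

section \<open>Divergences of fields homogeneous in the radius\<close>

text \<open>The trace of the Christoffel symbols with radial lower index is \<open>2 / r\<close>,
  one \<open>1 / r\<close> for each angular direction; this is the source of
  \<open>2 * w3\<close>.\<close>

lemma div10_cone:
  assumes y: "y \<in> D"
    and W: "\<And>z \<alpha>. z \<in> D \<Longrightarrow> W z $ emb \<alpha> = w (angular z) $ \<alpha> / z $ 3" "\<And>z. z \<in> D \<Longrightarrow> W z $ 3 = w3 (angular z)"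
    and diff: "\<And>\<alpha>. (\<lambda>\<zeta>. w \<zeta> $ \<alpha>) differentiable (at (angular y))"
  shows "div10 G W y = (div10 g w (angular y) + 2 * w3 (angular y)) / y $ 3"
proof -
  have "pd (emb \<alpha>) (\<lambda>z. W z $ emb \<alpha>) y = 1 / y $ 3 * pd \<alpha> (\<lambda>\<zeta>. w \<zeta> $ \<alpha>) (angular y)" for \<alpha>
    by (rule pd_emb_eqI[OF y diff]) (simp add: W)
  moreover have "pd 3 (\<lambda>z. W z $ 3) y = 0 * w3 (angular y)"
    by (rule pd_3_eqI[OF y, of "\<lambda>_. 1"]) (simp_all add: W)
  ultimately show ?thesis
    using domainD(2)[OF y]
    by (simp add: div10_def sum_emb christoffel_G[OF y] W[OF y] sum_divide_distrib[symmetric] sum.distrib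
        add_divide_distrib[symmetric])
qed

text \<open>The profiles \<open>r\<close> and \<open>r^2\<close> are those of weight-one fluxes:
  \<open>sqrt G\<close> carries \<open>r^2\<close>, a tangential component \<open>1 / r\<close>.
  Differentiating \<open>r^2\<close> gives the factor \<open>2\<close>.\<close>

lemma div11_cone:
  assumes y: "y \<in> D"
    and W: "\<And>z \<alpha>. z \<in> D \<Longrightarrow> W z $ emb \<alpha> = z $ 3 * w \<alpha> (angular z)" "\<And>z. z \<in> D \<Longrightarrow> W z $ 3 = (z $ 3)\<^sup>2 * w3 (angular z)"
    and diff: "\<And>\<alpha>. w \<alpha> differentiable (at (angular y))"
  shows "div11 W y = y $ 3 * ((\<Sum>\<alpha>\<in>UNIV. pd \<alpha> (w \<alpha>) (angular y)) + 2 * w3 (angular y))"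
proof -
  have "pd (emb \<alpha>) (\<lambda>z. W z $ emb \<alpha>) y = y $ 3 * pd \<alpha> (w \<alpha>) (angular y)" for \<alpha>
    by (rule pd_emb_eqI[OF y diff]) (simp add: W)
  moreover have "pd 3 (\<lambda>z. W z $ 3) y = (2 * y $ 3) * w3 (angular y)"
    by (rule pd_3_eqI[OF y, of "\<lambda>t. t\<^sup>2"]) (auto simp: W intro!: derivative_eq_intros)
  ultimately show ?thesis
    by (simp add: div11_def sum_emb sum_distrib_left[symmetric] algebra_simps)
qed

text \<open>The coefficient \<open>3\<close> is \<open>1 + 2\<close>: the radial derivative of
  \<open>r s\<close>, and two equal Christoffel terms with lower indices \<open>(\<beta>, 3)\<close>
  and \<open>(3, \<beta>)\<close>. In the radial component the symbols \<open>- r g\<close> are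
  contracted with \<open>t\<close>.\<close>

lemma div21_cone:
  assumes y: "y \<in> D"
    and W: "\<And>z \<alpha> \<beta>. z \<in> D \<Longrightarrow> W z $ emb \<alpha> $ emb \<beta> = t (angular z) $ \<alpha> $ \<beta>"
      "\<And>z \<alpha>. z \<in> D \<Longrightarrow> W z $ emb \<alpha> $ 3 = z $ 3 * s \<alpha> (angular z)"
      "\<And>z \<alpha>. z \<in> D \<Longrightarrow> W z $ 3 $ emb \<alpha> = z $ 3 * s \<alpha> (angular z)"
      "\<And>z. z \<in> D \<Longrightarrow> W z $ 3 $ 3 = (z $ 3)\<^sup>2 * q (angular z)"
    and diff: "\<And>\<alpha> \<beta>. (\<lambda>\<zeta>. t \<zeta> $ \<alpha> $ \<beta>) differentiable (at (angular y))"
      "\<And>\<alpha>. s \<alpha> differentiable (at (angular y))"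
  shows "div21 G W y (emb \<alpha>) = div21 g t (angular y) \<alpha> + 3 * s \<alpha> (angular y)"
    "div21 G W y 3 = y $ 3 * ((\<Sum>\<alpha>\<in>UNIV. pd \<alpha> (s \<alpha>) (angular y)) + 2 * q (angular y)
       - (\<Sum>\<alpha>\<in>UNIV. \<Sum>\<beta>\<in>UNIV. g (angular y) $ \<alpha> $ \<beta> * t (angular y) $ \<alpha> $ \<beta>))"
proof -
  have r: "y $ 3 \<noteq> 0"
    using domainD(2)[OF y] by simp
  have 1: "pd (emb \<beta>) (\<lambda>z. W z $ emb \<alpha> $ emb \<beta>) y = 1 * pd \<beta> (\<lambda>\<zeta>. t \<zeta> $ \<alpha> $ \<beta>) (angular y)" for \<alpha> \<beta>
    by (rule pd_emb_eqI[OF y diff(1)]) (simp add: W)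
  have 2: "pd (emb \<alpha>) (\<lambda>z. W z $ 3 $ emb \<alpha>) y = y $ 3 * pd \<alpha> (s \<alpha>) (angular y)" for \<alpha>
    by (rule pd_emb_eqI[OF y diff(2)]) (simp add: W)
  have 3: "pd 3 (\<lambda>z. W z $ emb \<alpha> $ 3) y = 1 * s \<alpha> (angular y)" for \<alpha>
    by (rule pd_3_eqI[OF y, of "\<lambda>t. t"]) (auto simp: W)
  have 4: "pd 3 (\<lambda>z. W z $ 3 $ 3) y = (2 * y $ 3) * q (angular y)"
    by (rule pd_3_eqI[OF y, of "\<lambda>t. t\<^sup>2"]) (auto simp: W intro!: derivative_eq_intros)
  show "div21 G W y (emb \<alpha>) = div21 g t (angular y) \<alpha> + 3 * s \<alpha> (angular y)"
    using r
    by (simp add: div21_def sum_emb 1 3 christoffel_G[OF y] W[OF y] sum.distrib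
        mult_delta_left)
  show "div21 G W y 3 = y $ 3 * ((\<Sum>\<alpha>\<in>UNIV. pd \<alpha> (s \<alpha>) (angular y)) + 2 * q (angular y)
       - (\<Sum>\<alpha>\<in>UNIV. \<Sum>\<beta>\<in>UNIV. g (angular y) $ \<alpha> $ \<beta> * t (angular y) $ \<alpha> $ \<beta>))"
    by (simp add: div21_def sum_emb 2 4 christoffel_G[OF y] W[OF y] sum_distrib_left
        sum_negf sum_subtractf algebra_simps)
qed

text \<open>By antisymmetry the mixed Christoffel terms of the tangential component cancel. The
  coefficient \<open>-1\<close> of \<open>s\<close> is \<open>1 - 2\<close>, from the radial
  derivative and from the trace \<open>2 / r\<close>.\<close>

lemma div20_cone:
  assumes y: "y \<in> D"
    and W: "\<And>z \<alpha> \<beta>. z \<in> D \<Longrightarrow> W z $ emb \<alpha> $ emb \<beta> = t (angular z) $ \<alpha> $ \<beta> / (z $ 3)\<^sup>2"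
      "\<And>z \<alpha>. z \<in> D \<Longrightarrow> W z $ emb \<alpha> $ 3 = - (s \<alpha> (angular z) / z $ 3)"
      "\<And>z \<alpha>. z \<in> D \<Longrightarrow> W z $ 3 $ emb \<alpha> = s \<alpha> (angular z) / z $ 3"
      "\<And>z. z \<in> D \<Longrightarrow> W z $ 3 $ 3 = 0"
    and antisym: "\<And>\<alpha> \<beta>. t (angular y) $ \<alpha> $ \<beta> = - t (angular y) $ \<beta> $ \<alpha>"
    and diff: "\<And>\<alpha> \<beta>. (\<lambda>\<zeta>. t \<zeta> $ \<alpha> $ \<beta>) differentiable (at (angular y))"
      "\<And>\<alpha>. s \<alpha> differentiable (at (angular y))"
  shows "div20 G W y (emb \<alpha>) = (div20 g t (angular y) \<alpha> - s \<alpha> (angular y)) / (y $ 3)\<^sup>2"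
    "div20 G W y 3 = ((\<Sum>\<alpha>\<in>UNIV. pd \<alpha> (s \<alpha>) (angular y)) +
       (\<Sum>\<alpha>\<in>UNIV. s \<alpha> (angular y) * (1 / sqrt (det (g (angular y)))) *
         pd \<alpha> (\<lambda>\<zeta>. sqrt (det (g \<zeta>))) (angular y))) / y $ 3"
proof -
  have r: "y $ 3 \<noteq> 0"
    using domainD(2)[OF y] by simp
  have 1: "pd (emb \<beta>) (\<lambda>z. W z $ emb \<alpha> $ emb \<beta>) y = 1 / (y $ 3)\<^sup>2 * pd \<beta> (\<lambda>\<zeta>. t \<zeta> $ \<alpha> $ \<beta>) (angular y)" for \<alpha> \<beta>
    by (rule pd_emb_eqI[OF y diff(1)]) (simp add: W)
  have 2: "pd (emb \<alpha>) (\<lambda>z. W z $ 3 $ emb \<alpha>) y = 1 / y $ 3 * pd \<alpha> (s \<alpha>) (angular y)" for \<alpha>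
    by (rule pd_emb_eqI[OF y diff(2)]) (simp add: W)
  have 3: "pd 3 (\<lambda>z. W z $ emb \<alpha> $ 3) y = 1 / (y $ 3)\<^sup>2 * s \<alpha> (angular y)" for \<alpha>
    by (rule pd_3_eqI[OF y, of "\<lambda>t. - (1 / t)"])
      (use r in \<open>auto simp: W power2_eq_square intro!: derivative_eq_intros\<close>)
  have 4: "pd 3 (\<lambda>z. W z $ 3 $ 3) y = 0 * 0"
    by (rule pd_3_eqI[OF y, of "\<lambda>_. 0"]) (auto simp: W)
  have anti: "t (angular y) $ 2 $ 1 = - t (angular y) $ 1 $ 2" "t (angular y) $ 1 $ 1 = 0"
    "t (angular y) $ 2 $ 2 = 0"
    using antisym[of 2 1] antisym[of 1 1] antisym[of 2 2] by simp_all
  have "(\<Sum>h\<in>UNIV. \<Sum>k\<in>UNIV. christoffel G y (emb \<alpha>) h k * W y $ h $ k)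
      = (\<Sum>\<beta>\<in>UNIV. \<Sum>\<nu>\<in>UNIV. christoffel g (angular y) \<alpha> \<beta> \<nu> * t (angular y) $ \<beta> $ \<nu>) / (y $ 3)\<^sup>2"
    using r
    by (simp add: sum_emb christoffel_G[OF y] W[OF y] sum.distrib sum_divide_distrib sum_negf
        mult_delta_left)
  moreover have "(\<Sum>h\<in>UNIV. \<Sum>k\<in>UNIV. christoffel G y k h k * W y $ emb \<alpha> $ h)
      = ((\<Sum>\<beta>\<in>UNIV. \<Sum>\<nu>\<in>UNIV. christoffel g (angular y) \<nu> \<beta> \<nu> * t (angular y) $ \<alpha> $ \<beta>)
        - 2 * s \<alpha> (angular y)) / (y $ 3)\<^sup>2"
    using r
    by (simp add: sum_emb christoffel_G[OF y] W[OF y] sum.distrib sum_divide_distrib diff_divide_distrib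
        power2_eq_square)
  moreover have "(\<Sum>j\<in>UNIV. pd j (\<lambda>z. W z $ emb \<alpha> $ j) y)
      = ((\<Sum>\<beta>\<in>UNIV. pd \<beta> (\<lambda>\<zeta>. t \<zeta> $ \<alpha> $ \<beta>) (angular y)) + s \<alpha> (angular y)) / (y $ 3)\<^sup>2"
    by (simp add: sum_emb 1 3 sum_divide_distrib add_divide_distrib)
  ultimately show "div20 G W y (emb \<alpha>) = (div20 g t (angular y) \<alpha> - s \<alpha> (angular y)) / (y $ 3)\<^sup>2"
    by (simp add: div20_def add_divide_distrib[symmetric] diff_divide_distrib[symmetric])
  \<comment> \<open>Here the symmetric \<open>g\<close> is contracted with the antisymmetric
    \<open>t\<close>.\<close>
  have "(\<Sum>h\<in>UNIV. \<Sum>k\<in>UNIV. christoffel G y 3 h k * W y $ h $ k) = 0"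
    by (simp add: sum_emb christoffel_G[OF y] W[OF y] sum_2 anti g_commute[of _ 2 1])
  moreover have "(\<Sum>h\<in>UNIV. \<Sum>k\<in>UNIV. christoffel G y k h k * W y $ 3 $ h)
      = (\<Sum>\<alpha>\<in>UNIV. (\<Sum>\<nu>\<in>UNIV. christoffel g (angular y) \<nu> \<alpha> \<nu>) * s \<alpha> (angular y)) / y $ 3"
    by (simp add: sum_emb christoffel_G[OF y] W[OF y] sum_divide_distrib sum_distrib_right)
  moreover have "(\<Sum>j\<in>UNIV. pd j (\<lambda>z. W z $ 3 $ j) y)
      = (\<Sum>\<alpha>\<in>UNIV. pd \<alpha> (s \<alpha>) (angular y)) / y $ 3"
    by (simp add: sum_emb 2 4 sum_divide_distrib)
  ultimately show "div20 G W y 3 = ((\<Sum>\<alpha>\<in>UNIV. pd \<alpha> (s \<alpha>) (angular y)) +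
       (\<Sum>\<alpha>\<in>UNIV. s \<alpha> (angular y) * (1 / sqrt (det (g (angular y)))) *
         pd \<alpha> (\<lambda>\<zeta>. sqrt (det (g \<zeta>))) (angular y))) / y $ 3"
    by (simp add: div20_def christoffel_trace_g[OF domainD(1)[OF y]] add_divide_distrib mult.commute)
qed

text \<open>Mixed products vanish because \<open>n\<close> is normal to the tangent vectors. The
  factors \<open>y $ 3\<close> are grouped with the tangential components so as to form the rescaled
  ones.\<close>

lemma inner_cone:
  assumes y: "y \<in> D"
  shows "W (polar n y) \<bullet> X (polar n y) =
    (\<Sum>\<alpha>\<in>UNIV. \<Sum>\<beta>\<in>UNIV. g (angular y) $ \<alpha> $ \<beta> *
       (y $ 3 * contravariant (polar n) W y $ emb \<alpha>) * (y $ 3 * contravariant (polar n) X y $ emb \<beta>))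
    + contravariant (polar n) W y $ 3 * contravariant (polar n) X y $ 3"
proof -
  note \<xi> = domainD(1)[OF y]
  have "W (polar n y) \<bullet> X (polar n y) =
    ((\<Sum>\<alpha>\<in>UNIV. (W (polar n y) \<bullet> dual \<alpha> (angular y)) *\<^sub>R pd \<alpha> n (angular y))
       + (W (polar n y) \<bullet> n (angular y)) *\<^sub>R n (angular y)) \<bullet>
    ((\<Sum>\<alpha>\<in>UNIV. (X (polar n y) \<bullet> dual \<alpha> (angular y)) *\<^sub>R pd \<alpha> n (angular y))
       + (X (polar n y) \<bullet> n (angular y)) *\<^sub>R n (angular y))"
    using frame_expansion[OF \<xi>] by metis
  then show ?thesis
    using domainD(2)[OF y] n_inner_pd_n[OF \<xi>]
    by (simp add: contravariant_polar[OF y] inner_add_left inner_add_right inner_sum_left inner_sum_right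
        sum_distrib_left g_nth inner_commute[of "pd _ _ _" "n _"] n_inner_n[OF \<xi>] sum_2 algebra_simps)
qed

text \<open>Every \<open>\<xi>\<close> in \<open>U\<close> lies below a point of \<open>D\<close>,
  for instance the one at radius \<open>1\<close>. This aligns the quantifiers of the two
  systems.\<close>

lemma all_domain: "(\<forall>y\<in>D. Q (angular y)) \<longleftrightarrow> (\<forall>\<xi>\<in>U. Q \<xi>)"
  using domainD(1) coords_domain[of _ 1] by (metis angular_coords zero_less_one)

end

section \<open>The conical state and its restriction to the sphere\<close>

locale conical_state = chart +
  fixes \<rho> E :: "real^3 \<Rightarrow> real" and V B :: "real^3 \<Rightarrow> real^3"
    and Q :: "(real \<times> real) set" and P :: "real \<times> real \<Rightarrow> real" and \<mu> r :: real
  assumes smooth: "smooth_on (cone_region U n) \<rho>" "smooth_on (cone_region U n) E"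
                "smooth_on (cone_region U n) V" "smooth_on (cone_region U n) B"
    and conical: "conical_scalar U n \<rho>" "conical_scalar U n E"
                 "conical_vector U n V" "conical_vector U n B"
    and gas_law: "smooth_on Q P"
                 "\<And>x. x \<in> cone_region U n \<Longrightarrow> (\<rho> x, E x - (norm (V x))\<^sup>2 / 2) \<in> Q"
    and mu: "\<mu> > 0"
    and r: "r > 0"
begin

text \<open>The abbreviations follow the \<open>let\<close> bindings of the two systems, so that the
  unfolded equations match the lemmas below syntactically.\<close>

abbreviation "sg \<equiv> \<lambda>\<xi>. sqrt (det (g \<xi>))"
abbreviation "Vc \<equiv> contravariant (polar n) V"
abbreviation "Bc \<equiv> contravariant (polar n) B"
abbreviation "\<rho>s \<equiv> surf_scalar n r \<rho>"
abbreviation "Es \<equiv> surf_scalar n r E"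
abbreviation "v \<equiv> surf_tangential n r V"
abbreviation "v3 \<equiv> surf_radial n r V"
abbreviation "b \<equiv> surf_tangential n r B"
abbreviation "b3 \<equiv> surf_radial n r B"
abbreviation "vv \<equiv> \<lambda>\<xi>. \<Sum>\<alpha>\<in>UNIV. \<Sum>\<beta>\<in>UNIV. g \<xi> $ \<alpha> $ \<beta> * v \<xi> $ \<alpha> * v \<xi> $ \<beta>"
abbreviation "bb \<equiv> \<lambda>\<xi>. \<Sum>\<alpha>\<in>UNIV. \<Sum>\<beta>\<in>UNIV. g \<xi> $ \<alpha> $ \<beta> * b \<xi> $ \<alpha> * b \<xi> $ \<beta>"
abbreviation "BB \<equiv> \<lambda>\<xi>. bb \<xi> + (b3 \<xi>)\<^sup>2"
abbreviation "VB \<equiv> \<lambda>\<xi>. (\<Sum>\<alpha>\<in>UNIV. \<Sum>\<beta>\<in>UNIV. g \<xi> $ \<alpha> $ \<beta> * v \<xi> $ \<alpha> * b \<xi> $ \<beta>) + v3 \<xi> * b3 \<xi>"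
abbreviation "p \<equiv> \<lambda>\<xi>. P (\<rho>s \<xi>, Es \<xi> - (vv \<xi> + (v3 \<xi>)\<^sup>2) / 2)"
abbreviation "pc \<equiv> \<lambda>y. P (\<rho> (polar n y), E (polar n y) - (V (polar n y) \<bullet> V (polar n y)) / 2)"

text \<open>A point and the one at radius \<open>r\<close> on its ray carry the same field values
  and the same frame. The factor \<open>r\<close> in \<open>surf_tangential\<close> cancels the
  division at the reference radius, which leaves the divisor \<open>y $ 3\<close>.\<close>

lemma conical_fields:
  assumes y: "y \<in> D"
  shows "\<rho> (polar n y) = \<rho>s (angular y)" "E (polar n y) = Es (angular y)"
    "Vc y $ emb \<alpha> = v (angular y) $ \<alpha> / y $ 3" "Vc y $ 3 = v3 (angular y)"
    "Bc y $ emb \<alpha> = b (angular y) $ \<alpha> / y $ 3" "Bc y $ 3 = b3 (angular y)"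
proof -
  note \<xi> = domainD(1)[OF y] and t = domainD(2)[OF y]
  have D: "coords (angular y) r \<in> D"
    using \<xi> r by simp
  have polar: "polar n y = y $ 3 *\<^sub>R n (angular y)"
    by (simp add: polar_def)
  show "\<rho> (polar n y) = \<rho>s (angular y)" "E (polar n y) = Es (angular y)"
    using conical_scalar_ray[OF smooth(1) conical(1) \<xi> t r]
      conical_scalar_ray[OF smooth(2) conical(2) \<xi> t r]
    by (simp_all add: surf_scalar_def polar)
  show "Vc y $ emb \<alpha> = v (angular y) $ \<alpha> / y $ 3" "Vc y $ 3 = v3 (angular y)"
    "Bc y $ emb \<alpha> = b (angular y) $ \<alpha> / y $ 3" "Bc y $ 3 = b3 (angular y)"
    using conical_vector_ray[OF smooth(3) conical(3) \<xi> t r]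
      conical_vector_ray[OF smooth(4) conical(4) \<xi> t r] r
    by (simp_all add: surf_tangential_def surf_radial_def Let_def vector_scale_nth polar
        contravariant_polar[OF y] contravariant_polar[OF D])
qed

lemma conical_products:
  assumes y: "y \<in> D"
  shows "V (polar n y) \<bullet> V (polar n y) = vv (angular y) + (v3 (angular y))\<^sup>2"
    "B (polar n y) \<bullet> B (polar n y) = BB (angular y)"
    "V (polar n y) \<bullet> B (polar n y) = VB (angular y)"
    "pc y = p (angular y)"
proof -
  show VV: "V (polar n y) \<bullet> V (polar n y) = vv (angular y) + (v3 (angular y))\<^sup>2"
    and "B (polar n y) \<bullet> B (polar n y) = BB (angular y)"
    and "V (polar n y) \<bullet> B (polar n y) = VB (angular y)"
    using domainD(2)[OF y]
    by (simp_all add: inner_cone[OF y] conical_fields[OF y] power2_eq_square)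
  then show "pc y = p (angular y)"
    by (simp add: conical_fields[OF y])
qed

text \<open>On \<open>U\<close> these components are the inner products of
  \<open>W (r *\<^sub>R n \<zeta>)\<close> with \<open>dual \<alpha> \<zeta>\<close> and
  \<open>n \<zeta>\<close>, all differentiable in \<open>\<zeta>\<close>.\<close>

lemma surface_vector_diff:
  assumes W: "smooth_on (cone_region U n) W" and \<xi>: "\<xi> \<in> U"
  shows "(\<lambda>\<zeta>. surf_tangential n r W \<zeta> $ \<alpha>) differentiable (at \<xi>)"
    "surf_radial n r W differentiable (at \<xi>)"
proof -
  have eq: "W (r *\<^sub>R n \<zeta>) \<bullet> dual \<alpha> \<zeta> = surf_tangential n r W \<zeta> $ \<alpha>"
    "W (r *\<^sub>R n \<zeta>) \<bullet> n \<zeta> = surf_radial n r W \<zeta>" if "\<zeta> \<in> U" for \<zeta>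
  proof -
    have D: "coords \<zeta> r \<in> D"
      using that r by simp
    show "W (r *\<^sub>R n \<zeta>) \<bullet> dual \<alpha> \<zeta> = surf_tangential n r W \<zeta> $ \<alpha>"
      "W (r *\<^sub>R n \<zeta>) \<bullet> n \<zeta> = surf_radial n r W \<zeta>"
      using r by (simp_all add: surf_tangential_def surf_radial_def Let_def vector_scale_nth contravariant_polar[OF D])
  qed
  note diff = differentiable_inner[OF surface_diff[OF W \<xi> r]]
  show "(\<lambda>\<zeta>. surf_tangential n r W \<zeta> $ \<alpha>) differentiable (at \<xi>)"
    by (rule differentiable_cong_open[OF diff[OF dual_diff[OF \<xi>]] open_U \<xi> eq(1)])
  show "surf_radial n r W differentiable (at \<xi>)"
    by (rule differentiable_cong_open[OF diff[OF n_diff[OF \<xi>]] open_U \<xi> eq(2)])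
qed

lemma surface_fields_diff:
  assumes \<xi>: "\<xi> \<in> U"
  shows "(\<lambda>\<zeta>. v \<zeta> $ \<alpha>) differentiable (at \<xi>)" "(\<lambda>\<zeta>. b \<zeta> $ \<alpha>) differentiable (at \<xi>)"
    "v3 differentiable (at \<xi>)" "b3 differentiable (at \<xi>)"
    "\<rho>s differentiable (at \<xi>)" "Es differentiable (at \<xi>)"
    "BB differentiable (at \<xi>)" "VB differentiable (at \<xi>)" "p differentiable (at \<xi>)"
proof -
  show v: "(\<lambda>\<zeta>. v \<zeta> $ \<alpha>) differentiable (at \<xi>)" "v3 differentiable (at \<xi>)"
    and b: "(\<lambda>\<zeta>. b \<zeta> $ \<alpha>) differentiable (at \<xi>)" "b3 differentiable (at \<xi>)" for \<alpha>
    using surface_vector_diff \<xi> smooth(3,4) by auto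
  show \<rho>E: "\<rho>s differentiable (at \<xi>)" "Es differentiable (at \<xi>)"
    using surface_diff[OF _ \<xi> r] smooth(1,2) by (simp_all add: surf_scalar_def[abs_def])
  note diff = v b g_diff[OF \<xi>]
  show "BB differentiable (at \<xi>)" "VB differentiable (at \<xi>)"
    unfolding power2_eq_square
    by (intro differentiable_add differentiable_sum differentiable_mult diff ballI finite_class.finite_UNIV)+
  have "(\<lambda>\<xi>. vv \<xi> + (v3 \<xi>)\<^sup>2) differentiable (at \<xi>)"
    unfolding power2_eq_square
    by (intro differentiable_add differentiable_sum differentiable_mult diff ballI finite_class.finite_UNIV)+
  then have "(\<lambda>\<xi>. (\<rho>s \<xi>, Es \<xi> - (vv \<xi> + (v3 \<xi>)\<^sup>2) / 2)) differentiable (at \<xi>)"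
    using \<rho>E by (intro differentiable_Pair differentiable_diff) simp_all
  moreover have "P differentiable (at (\<rho>s \<xi>, Es \<xi> - (vv \<xi> + (v3 \<xi>)\<^sup>2) / 2))"
  proof (rule smooth_on_differentiable[OF gas_law(1)])
    \<comment> \<open>Membership in \<open>Q\<close> is given at points of the cone; the one at
      radius \<open>1\<close> above \<open>\<xi>\<close> has the same state variables.\<close>
    have D: "coords \<xi> 1 \<in> D"
      using \<xi> by simp
    show "(\<rho>s \<xi>, Es \<xi> - (vv \<xi> + (v3 \<xi>)\<^sup>2) / 2) \<in> Q"
      using gas_law(2)[OF polar_cone[OF D]]
      by (simp add: conical_fields[OF D, simplified] power2_norm_eq_inner conical_products(1)[OF D, simplified])
  qed
  ultimately show "p differentiable (at \<xi>)"
    using differentiable_chain_at[of "\<lambda>\<xi>. (\<rho>s \<xi>, Es \<xi> - (vv \<xi> + (v3 \<xi>)\<^sup>2) / 2)" \<xi> P] by (simp add: o_def)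
qed

lemma fluxes_diff:
  assumes \<xi>: "\<xi> \<in> U"
  shows "(\<lambda>\<zeta>. \<rho>s \<zeta> * sg \<zeta> * v \<zeta> $ \<alpha>) differentiable (at \<xi>)"
    "(\<lambda>\<zeta>. sg \<zeta> * (\<rho>s \<zeta> * v \<zeta> $ \<alpha> * v \<zeta> $ \<beta> - 1 / \<mu> * b \<zeta> $ \<alpha> * b \<zeta> $ \<beta>
      + matrix_inv (g \<zeta>) $ \<alpha> $ \<beta> * (p \<zeta> + BB \<zeta> / (2 * \<mu>)))) differentiable (at \<xi>)"
    "(\<lambda>\<zeta>. \<rho>s \<zeta> * sg \<zeta> * v3 \<zeta> * v \<zeta> $ \<alpha> - sg \<zeta> / \<mu> * b3 \<zeta> * b \<zeta> $ \<alpha>) differentiable (at \<xi>)"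
    "(\<lambda>\<zeta>. sg \<zeta> * ((\<rho>s \<zeta> * Es \<zeta> + p \<zeta> + BB \<zeta> / \<mu>) * v \<zeta> $ \<alpha> - 1 / \<mu> * VB \<zeta> * b \<zeta> $ \<alpha>)) differentiable (at \<xi>)"
    "(\<lambda>\<zeta>. v \<zeta> $ \<beta> * b \<zeta> $ \<alpha> - v \<zeta> $ \<alpha> * b \<zeta> $ \<beta>) differentiable (at \<xi>)"
    "(\<lambda>\<zeta>. v \<zeta> $ \<alpha> * b3 \<zeta> - v3 \<zeta> * b \<zeta> $ \<alpha>) differentiable (at \<xi>)"
  by - (rule differentiable_const surface_fields_diff[OF \<xi>] sqrt_det_g_diff[OF \<xi>] matrix_inv_g_diff[OF \<xi>]
      differentiable_add differentiable_diff differentiable_mult differentiable_divide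
      | simp add: less_imp_neq[OF mu, symmetric])+

section \<open>Comparison of the equations one by one\<close>

lemma divergence_B:
  "y \<in> D \<Longrightarrow> div10 G Bc y = (div10 g b (angular y) + 2 * b3 (angular y)) / y $ 3"
  by (intro div10_cone surface_fields_diff) (simp_all add: conical_fields domainD)

text \<open>The fluxes have the profiles of \<open>div11_cone\<close>, so the divergence is the
  positive radius times the left-hand side on the sphere.\<close>

lemma continuity_cone:
  assumes y: "y \<in> D"
  shows "div11 (\<lambda>z. \<chi> j. \<rho> (polar n z) * sqrt (det (G z)) * Vc z $ j) y = 0 \<longleftrightarrow>
    (\<Sum>\<beta>\<in>UNIV. pd \<beta> (\<lambda>\<zeta>. \<rho>s \<zeta> * sg \<zeta> * v \<zeta> $ \<beta>) (angular y))
      + 2 * \<rho>s (angular y) * sg (angular y) * v3 (angular y) = 0"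
proof -
  have "div11 (\<lambda>z. \<chi> j. \<rho> (polar n z) * sqrt (det (G z)) * Vc z $ j) y
    = y $ 3 * ((\<Sum>\<beta>\<in>UNIV. pd \<beta> (\<lambda>\<zeta>. \<rho>s \<zeta> * sg \<zeta> * v \<zeta> $ \<beta>) (angular y))
        + 2 * (\<rho>s (angular y) * sg (angular y) * v3 (angular y)))"
    by (rule div11_cone[OF y])
      (auto simp: conical_fields sqrt_det_G power2_eq_square dest: domainD
        intro!: fluxes_diff domainD[OF y])
  then show ?thesis
    using domainD(2)[OF y] by (simp add: mult.assoc)
qed

text \<open>The squared radius in \<open>sqrt (det (G y))\<close> makes up for two tangential
  indices. So the tangential equation carries no power of the radius, and the radial one is
  multiplied by the radius.\<close>

lemma momentum_cone:
  assumes y: "y \<in> D"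
  defines "W \<equiv> \<lambda>z. \<chi> i j. sqrt (det (G z)) * (\<rho> (polar n z) * Vc z $ i * Vc z $ j - 1 / \<mu> * Bc z $ i * Bc z $ j
      + matrix_inv (G z) $ i $ j * (pc z + B (polar n z) \<bullet> B (polar n z) / (2 * \<mu>)))"
    and "t \<equiv> \<lambda>\<zeta>. \<chi> \<alpha> \<beta>. sg \<zeta> * (\<rho>s \<zeta> * v \<zeta> $ \<alpha> * v \<zeta> $ \<beta> - 1 / \<mu> * b \<zeta> $ \<alpha> * b \<zeta> $ \<beta>
      + matrix_inv (g \<zeta>) $ \<alpha> $ \<beta> * (p \<zeta> + BB \<zeta> / (2 * \<mu>)))"
  shows "div21 G W y (emb \<alpha>) = - (sqrt (det (G y)) / \<mu>) * Bc y $ emb \<alpha> * div10 G Bc y \<longleftrightarrow>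
      div21 g t (angular y) \<alpha>
        + 3 * sg (angular y) * (\<rho>s (angular y) * v (angular y) $ \<alpha> * v3 (angular y)
            - 1 / \<mu> * b (angular y) $ \<alpha> * b3 (angular y))
      = - (sg (angular y) / \<mu>) * b (angular y) $ \<alpha> * (div10 g b (angular y) + 2 * b3 (angular y))"
    (is "?L \<longleftrightarrow> ?L'")
    and "div21 G W y 3 = - (sqrt (det (G y)) / \<mu>) * Bc y $ 3 * div10 G Bc y \<longleftrightarrow>
      (\<Sum>\<alpha>\<in>UNIV. pd \<alpha> (\<lambda>\<zeta>. \<rho>s \<zeta> * sg \<zeta> * v3 \<zeta> * v \<zeta> $ \<alpha> - sg \<zeta> / \<mu> * b3 \<zeta> * b \<zeta> $ \<alpha>) (angular y))
        + 2 * sg (angular y) * (\<rho>s (angular y) * (v3 (angular y))\<^sup>2 - 1 / \<mu> * (b3 (angular y))\<^sup>2)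
        - \<rho>s (angular y) * sg (angular y) * vv (angular y) + sg (angular y) / \<mu> * bb (angular y)
      = - (sg (angular y) / \<mu>) * b3 (angular y) * (div10 g b (angular y) + 2 * b3 (angular y))"
    (is "?M \<longleftrightarrow> ?L3 = ?R3")
proof -
  note \<xi> = domainD(1)[OF y]
  \<comment> \<open>The mixed tangential-radial flux. It contains no pressure, since the inverse
    metric has no mixed entries, and it is also the flux of the radial momentum equation on the
    sphere.\<close>
  define s where "s \<alpha> \<zeta> = \<rho>s \<zeta> * sg \<zeta> * v3 \<zeta> * v \<zeta> $ \<alpha> - sg \<zeta> / \<mu> * b3 \<zeta> * b \<zeta> $ \<alpha>" for \<alpha> \<zeta>
  \<comment> \<open>The total pressure, kept opaque so that the algebra does not expand
    \<open>P\<close> and the double sums.\<close>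
  define K where "K \<zeta> = p \<zeta> + BB \<zeta> / (2 * \<mu>)" for \<zeta>
  define q where "q \<zeta> = sg \<zeta> * (\<rho>s \<zeta> * (v3 \<zeta>)\<^sup>2 - 1 / \<mu> * (b3 \<zeta>)\<^sup>2 + K \<zeta>)" for \<zeta>
  \<comment> \<open>Here \<open>z\<close> is the radius: its square, from the volume element,
    cancels one \<open>1 / z\<close> from each tangential factor and \<open>1 / z^2\<close> from the
    inverse metric.\<close>
  have scale: "z\<^sup>2 * c * (d * (e / z) * (f / z) - m * (h / z) * (k / z) + i / z\<^sup>2 * x)
      = c * (d * e * f - m * h * k + i * x)" if "z > 0" for z c d e f m h k i x :: real
    using that by (simp add: power2_eq_square field_simps)
  have K: "pc z + B (polar n z) \<bullet> B (polar n z) / (2 * \<mu>) = K (angular z)" if "z \<in> D" for z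
    by (simp only: conical_products[OF that] conical_fields[OF that] K_def)
  have t: "t = (\<lambda>\<zeta>. \<chi> \<alpha> \<beta>. sg \<zeta> * (\<rho>s \<zeta> * v \<zeta> $ \<alpha> * v \<zeta> $ \<beta> - 1 / \<mu> * b \<zeta> $ \<alpha> * b \<zeta> $ \<beta>
      + matrix_inv (g \<zeta>) $ \<alpha> $ \<beta> * K \<zeta>))"
    by (simp add: t_def K_def)
  have W1: "W z $ emb \<alpha> $ emb \<beta> = t (angular z) $ \<alpha> $ \<beta>" if "z \<in> D" for z \<alpha> \<beta>
    unfolding W_def t vec_lambda_beta K[OF that]
    by (simp only: conical_fields[OF that] sqrt_det_G[OF that]
        matrix_inv_G[OF that] scale domainD[OF that])
  have W2: "W z $ emb \<alpha> $ 3 = z $ 3 * s \<alpha> (angular z)" "W z $ 3 $ emb \<alpha> = z $ 3 * s \<alpha> (angular z)"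
    if "z \<in> D" for z \<alpha>
    using domainD(2)[OF that]
    by (simp_all add: W_def s_def conical_fields[OF that] sqrt_det_G[OF that] matrix_inv_G[OF that]
        power2_eq_square algebra_simps)
  have W3: "W z $ 3 $ 3 = (z $ 3)\<^sup>2 * q (angular z)" if "z \<in> D" for z
    using domainD(2)[OF that]
    unfolding W_def q_def vec_lambda_beta K[OF that]
    by (simp add: conical_fields[OF that] sqrt_det_G[OF that] matrix_inv_G[OF that] power2_eq_square)
  have td: "(\<lambda>\<zeta>. t \<zeta> $ \<alpha> $ \<beta>) differentiable (at (angular y))" for \<alpha> \<beta>
    unfolding t_def vec_lambda_beta by (rule fluxes_diff[OF \<xi>])
  have sd: "s \<alpha> differentiable (at (angular y))" for \<alpha>
    unfolding s_def[abs_def] by (rule fluxes_diff[OF \<xi>])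
  have div: "div21 G W y (emb \<alpha>) = div21 g t (angular y) \<alpha> + 3 * s \<alpha> (angular y)"
    "div21 G W y 3 = y $ 3 * ((\<Sum>\<alpha>\<in>UNIV. pd \<alpha> (s \<alpha>) (angular y)) + 2 * q (angular y)
       - (\<Sum>\<alpha>\<in>UNIV. \<Sum>\<beta>\<in>UNIV. g (angular y) $ \<alpha> $ \<beta> * t (angular y) $ \<alpha> $ \<beta>))"
    by (rule div21_cone[OF y]; (rule td sd | erule W1 W2 W3))+
  show "?L \<longleftrightarrow> ?L'"
  proof -
    have "div21 G W y (emb \<alpha>) = div21 g t (angular y) \<alpha> + 3 * sg (angular y) *
        (\<rho>s (angular y) * v (angular y) $ \<alpha> * v3 (angular y) - 1 / \<mu> * b (angular y) $ \<alpha> * b3 (angular y))"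
      unfolding div by (simp add: s_def algebra_simps)
    moreover have "- (sqrt (det (G y)) / \<mu>) * Bc y $ emb \<alpha> * div10 G Bc y
        = - (sg (angular y) / \<mu>) * b (angular y) $ \<alpha> * (div10 g b (angular y) + 2 * b3 (angular y))"
      using domainD(2)[OF y]
      by (simp add: divergence_B[OF y] conical_fields[OF y] sqrt_det_G[OF y] power2_eq_square)
    ultimately show ?thesis
      by (simp only:)
  qed
  show "?M \<longleftrightarrow> ?L3 = ?R3"
  proof -
    \<comment> \<open>Symmetry of the inverse brings the double sum into the order of a matrix
      product, whose trace is that of the identity.\<close>
    have "(\<Sum>\<alpha>\<in>UNIV. \<Sum>\<beta>\<in>UNIV. g (angular y) $ \<alpha> $ \<beta> * matrix_inv (g (angular y)) $ \<alpha> $ \<beta>)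
        = (\<Sum>\<alpha>\<in>UNIV. \<Sum>\<beta>\<in>UNIV. g (angular y) $ \<alpha> $ \<beta> * matrix_inv (g (angular y)) $ \<beta> $ \<alpha>)"
      by (simp add: inv_g_commute[OF \<xi>])
    then have trace: "(\<Sum>\<alpha>\<in>UNIV. \<Sum>\<beta>\<in>UNIV. g (angular y) $ \<alpha> $ \<beta> * matrix_inv (g (angular y)) $ \<alpha> $ \<beta>) = 2"
      by (simp add: g_inv[OF \<xi>] sum_2)
    have "(\<Sum>\<alpha>\<in>UNIV. \<Sum>\<beta>\<in>UNIV. g (angular y) $ \<alpha> $ \<beta> * t (angular y) $ \<alpha> $ \<beta>)
      = sg (angular y) * (\<rho>s (angular y) * vv (angular y) - 1 / \<mu> * bb (angular y)
        + (\<Sum>\<alpha>\<in>UNIV. \<Sum>\<beta>\<in>UNIV. g (angular y) $ \<alpha> $ \<beta> * matrix_inv (g (angular y)) $ \<alpha> $ \<beta>) * K (angular y))"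
      unfolding t vec_lambda_beta sum_2 by (simp add: algebra_simps)
    \<comment> \<open>The term \<open>2 * sg * K\<close> in \<open>2 * q\<close> is removed by the
      trace term, so the pressure drops out.\<close>
    then have *: "2 * q (angular y) - (\<Sum>\<alpha>\<in>UNIV. \<Sum>\<beta>\<in>UNIV. g (angular y) $ \<alpha> $ \<beta> * t (angular y) $ \<alpha> $ \<beta>)
      = 2 * sg (angular y) * (\<rho>s (angular y) * (v3 (angular y))\<^sup>2 - 1 / \<mu> * (b3 (angular y))\<^sup>2)
        - \<rho>s (angular y) * sg (angular y) * vv (angular y) + sg (angular y) / \<mu> * bb (angular y)"
      unfolding trace q_def by (simp add: right_diff_distrib distrib_left mult.assoc mult.left_commute)
    have "div21 G W y 3 = y $ 3 * ?L3"
      unfolding div add_diff_eq[symmetric] * by (simp only: s_def[abs_def] add_diff_eq add.assoc[symmetric])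
    moreover have "- (sqrt (det (G y)) / \<mu>) * Bc y $ 3 * div10 G Bc y = y $ 3 * ?R3"
      using domainD(2)[OF y]
      by (simp add: divergence_B[OF y] conical_fields[OF y] sqrt_det_G[OF y] power2_eq_square)
    moreover have "y $ 3 \<noteq> 0"
      using domainD(2)[OF y] by simp
    ultimately show ?thesis
      by (simp only: mult_cancel_left) simp
  qed
qed

text \<open>The scalar coefficients do not depend on the radius, so the fluxes have the same
  profiles as in the continuity equation; both sides are the radius times their spherical
  counterparts.\<close>

lemma energy_cone:
  assumes y: "y \<in> D"
  shows "div11 (\<lambda>z. \<chi> j. sqrt (det (G z)) * ((\<rho> (polar n z) * E (polar n z) + pc z
        + B (polar n z) \<bullet> B (polar n z) / \<mu>) * Vc z $ j - 1 / \<mu> * (V (polar n z) \<bullet> B (polar n z)) * Bc z $ j)) y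
      = - (sqrt (det (G y)) / \<mu>) * (V (polar n y) \<bullet> B (polar n y)) * div10 G Bc y \<longleftrightarrow>
    (\<Sum>\<beta>\<in>UNIV. pd \<beta> (\<lambda>\<zeta>. sg \<zeta> * ((\<rho>s \<zeta> * Es \<zeta> + p \<zeta> + BB \<zeta> / \<mu>) * v \<zeta> $ \<beta> - 1 / \<mu> * VB \<zeta> * b \<zeta> $ \<beta>)) (angular y))
      + 2 * sg (angular y) * ((\<rho>s (angular y) * Es (angular y) + p (angular y) + BB (angular y) / \<mu>) * v3 (angular y)
          - 1 / \<mu> * VB (angular y) * b3 (angular y))
      = - (sg (angular y) / \<mu>) * VB (angular y) * (div10 g b (angular y) + 2 * b3 (angular y))"
    (is "div11 ?W y = ?R \<longleftrightarrow> ?S + 2 * sg (angular y) * ?q = ?R'")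
proof -
  \<comment> \<open>\<open>H\<close> and \<open>M\<close> hide the scalar coefficients, so that
    powers of the radius can be sorted without expanding them.\<close>
  define H where "H \<zeta> = \<rho>s \<zeta> * Es \<zeta> + p \<zeta> + BB \<zeta> / \<mu>" for \<zeta>
  define M where "M \<zeta> = VB \<zeta>" for \<zeta>
  have H: "\<rho> (polar n z) * E (polar n z) + pc z + B (polar n z) \<bullet> B (polar n z) / \<mu> = H (angular z)" if "z \<in> D" for z
    by (simp only: conical_products[OF that] conical_fields[OF that] H_def)
  have M: "V (polar n z) \<bullet> B (polar n z) = M (angular z)" if "z \<in> D" for z
    by (simp only: conical_products[OF that] M_def)
  have "div11 ?W y = y $ 3 * (?S + 2 * (sg (angular y) * ?q))"
  proof (rule div11_cone[OF y])
    fix z \<alpha> assume z: "z \<in> D"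
    show "?W z $ emb \<alpha> = z $ 3 * (sg (angular z) *
        ((\<rho>s (angular z) * Es (angular z) + p (angular z) + BB (angular z) / \<mu>) * v (angular z) $ \<alpha>
          - 1 / \<mu> * VB (angular z) * b (angular z) $ \<alpha>))"
      unfolding H_def[symmetric] M_def[symmetric] vec_lambda_beta H[OF z] M[OF z]
      using domainD(2)[OF z]
      by (simp add: conical_fields[OF z] sqrt_det_G[OF z] power2_eq_square field_simps)
    show "?W z $ 3 = (z $ 3)\<^sup>2 * (sg (angular z) *
        ((\<rho>s (angular z) * Es (angular z) + p (angular z) + BB (angular z) / \<mu>) * v3 (angular z)
          - 1 / \<mu> * VB (angular z) * b3 (angular z)))"
      unfolding H_def[symmetric] M_def[symmetric] vec_lambda_beta H[OF z] M[OF z]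
      by (simp add: conical_fields[OF z] sqrt_det_G[OF z])
  qed (rule fluxes_diff[OF domainD(1)[OF y]])
  moreover have "?R = y $ 3 * ?R'"
    unfolding M_def[symmetric] M[OF y] using domainD(2)[OF y]
    by (simp add: divergence_B[OF y] sqrt_det_G[OF y] power2_eq_square)
  ultimately show ?thesis
    using domainD(2)[OF y] by (simp only: mult_cancel_left mult.assoc) simp
qed

text \<open>The tensor has weight zero, so no volume factor makes up for the division by the radius:
  both sides carry its power \<open>-2\<close> in the tangential equation and \<open>-1\<close> in
  the radial one.\<close>

lemma induction_cone:
  assumes y: "y \<in> D"
  defines "W \<equiv> \<lambda>z. \<chi> i j. Vc z $ j * Bc z $ i - Vc z $ i * Bc z $ j"
    and "t \<equiv> \<lambda>\<zeta>. \<chi> \<alpha> \<beta>. v \<zeta> $ \<beta> * b \<zeta> $ \<alpha> - v \<zeta> $ \<alpha> * b \<zeta> $ \<beta>"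
  shows "div20 G W y (emb \<alpha>) = - Vc y $ emb \<alpha> * div10 G Bc y \<longleftrightarrow>
      div20 g t (angular y) \<alpha>
        + (v3 (angular y) * b (angular y) $ \<alpha> - v (angular y) $ \<alpha> * b3 (angular y))
      = - v (angular y) $ \<alpha> * (div10 g b (angular y) + 2 * b3 (angular y))" (is "?L \<longleftrightarrow> ?L'")
    and "div20 G W y 3 = - Vc y $ 3 * div10 G Bc y \<longleftrightarrow>
      (\<Sum>\<beta>\<in>UNIV. pd \<beta> (\<lambda>\<zeta>. v \<zeta> $ \<beta> * b3 \<zeta> - v3 \<zeta> * b \<zeta> $ \<beta>) (angular y))
        + (\<Sum>\<beta>\<in>UNIV. (v (angular y) $ \<beta> * b3 (angular y) - v3 (angular y) * b (angular y) $ \<beta>)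
            * (1 / sg (angular y)) * pd \<beta> sg (angular y))
      = - v3 (angular y) * (div10 g b (angular y) + 2 * b3 (angular y))" (is "?M \<longleftrightarrow> ?M'")
proof -
  note \<xi> = domainD(1)[OF y] and r = domainD(2)[OF y]
  \<comment> \<open>The entry with radial first index, up to the radius. The antisymmetric entry
    gives \<open>- s\<close>, which is the undifferentiated term of the tangential equation.\<close>
  define s where "s \<alpha> \<zeta> = v \<zeta> $ \<alpha> * b3 \<zeta> - v3 \<zeta> * b \<zeta> $ \<alpha>" for \<alpha> \<zeta>
  have W: "W z $ emb \<alpha> $ emb \<beta> = t (angular z) $ \<alpha> $ \<beta> / (z $ 3)\<^sup>2"
    "W z $ emb \<alpha> $ 3 = - (s \<alpha> (angular z) / z $ 3)" "W z $ 3 $ emb \<alpha> = s \<alpha> (angular z) / z $ 3"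
    "W z $ 3 $ 3 = 0" if "z \<in> D" for z \<alpha> \<beta>
    by (simp_all add: W_def t_def s_def conical_fields[OF that] power2_eq_square
        diff_divide_distrib)
  have td: "(\<lambda>\<zeta>. t \<zeta> $ \<alpha> $ \<beta>) differentiable (at (angular y))" for \<alpha> \<beta>
    unfolding t_def vec_lambda_beta by (rule fluxes_diff[OF \<xi>])
  have sd: "s \<alpha> differentiable (at (angular y))" for \<alpha>
    unfolding s_def[abs_def] by (rule fluxes_diff[OF \<xi>])
  have anti: "t (angular y) $ \<alpha> $ \<beta> = - t (angular y) $ \<beta> $ \<alpha>" for \<alpha> \<beta>
    by (simp add: t_def)
  have div: "div20 G W y (emb \<alpha>) = (div20 g t (angular y) \<alpha> - s \<alpha> (angular y)) / (y $ 3)\<^sup>2"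
    "div20 G W y 3 = ((\<Sum>\<alpha>\<in>UNIV. pd \<alpha> (s \<alpha>) (angular y)) +
       (\<Sum>\<alpha>\<in>UNIV. s \<alpha> (angular y) * (1 / sg (angular y)) * pd \<alpha> sg (angular y))) / y $ 3"
    by (rule div20_cone[OF y]; (rule td sd anti | erule W))+
  show "?L \<longleftrightarrow> ?L'"
  proof -
    have "- Vc y $ emb \<alpha> * div10 G Bc y
        = - v (angular y) $ \<alpha> * (div10 g b (angular y) + 2 * b3 (angular y)) / (y $ 3)\<^sup>2"
      by (simp add: divergence_B[OF y] conical_fields[OF y] power2_eq_square)
    moreover have "(y $ 3)\<^sup>2 \<noteq> 0"
      using r by simp
    ultimately show ?thesis
      unfolding div by (simp only: divide_cancel_right) (simp add: s_def algebra_simps)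
  qed
  show "?M \<longleftrightarrow> ?M'"
    unfolding div divergence_B[OF y] conical_fields[OF y] s_def[abs_def]
    using r by (simp add: minus_divide_left del: divide_minus_left)
qed

section \<open>Equivalence of the two systems\<close>

text \<open>\<open>all_domain\<close> turns the quantifier over \<open>U\<close> into one over
  \<open>D\<close>. The systems then agree point by point and equation by equation, with Latin free
  indices split by \<open>all_emb\<close>.\<close>

theorem powell_mhd_iff_spherical_mhd:
  "powell_mhd D (polar n) P \<mu> \<rho> V E B \<longleftrightarrow> spherical_mhd U n P \<mu> \<rho>s v v3 Es b b3"
  unfolding powell_mhd_def spherical_mhd_def Let_def all_domain[symmetric]
  by (rule ball_cong[OF refl])
    (simp only: all_emb continuity_cone momentum_cone energy_cone induction_cone conj_assoc)

end

theorem mainTheorem1: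
  fixes U :: "(real^2) set" and n :: "real^2 \<Rightarrow> real^3"
    and \<rho> E :: "real^3 \<Rightarrow> real" and V B :: "real^3 \<Rightarrow> real^3"
    and Q :: "(real \<times> real) set" and P :: "real \<times> real \<Rightarrow> real" and \<mu> r :: real
  assumes chart: "sphere_chart U n"
    and smooth: "smooth_on (cone_region U n) \<rho>" "smooth_on (cone_region U n) E"
                "smooth_on (cone_region U n) V" "smooth_on (cone_region U n) B"
    and conical: "conical_scalar U n \<rho>" "conical_scalar U n E"
                 "conical_vector U n V" "conical_vector U n B"
    and gas_law: "open Q" "smooth_on Q P"
                 "\<And>x. x \<in> cone_region U n \<Longrightarrow> (\<rho> x, E x - (norm (V x))\<^sup>2 / 2) \<in> Q"
    and mu: "\<mu> > 0"
    and r: "r > 0"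
  shows "powell_mhd (coord_domain U) (polar n) P \<mu> \<rho> V E B \<longleftrightarrow>
         spherical_mhd U n P \<mu>
           (surf_scalar n r \<rho>) (surf_tangential n r V) (surf_radial n r V) (surf_scalar n r E)
           (surf_tangential n r B) (surf_radial n r B)"
proof -
  interpret conical_state U n \<rho> E V B Q P \<mu> r
    by unfold_locales fact+
  show ?thesis
    by (rule powell_mhd_iff_spherical_mhd)
qed

end
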